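(* Let $q\ge2$ be an integer and let $G$ be a closed non-compact subgroup of $\mathrm{Aut}(\mathcal{T}_{q+1})$ acting transitively on the vertices and on the boundary of the $(q+1)$-regular tree $\mathcal{T}_{q+1}=(V,\mathbb{E})$. Fix a basepoint $x_0\in V$, set $|g|:=d(x_0,gx_0)$ for $g\in G$, and let $\tilde b(g)=(1-Q)\chi_{x_0\to gx_0}$ be the projection of the Haagerup cocycle onto the closed invariant subspace $\ker\nabla^*$ of $\ell^2_{\mathrm{alt}}(\mathbb{E})$. Then the cocycle $\tilde b$ is proper and satisfies, for all $g\in G$, $$\|\tilde b(g)\|^2=|g|+\frac{2q}{q^2-1}\left(q^{-|g|}-1\right).$$ In particular, the $G$-equivariant map $F:V\to\ker\nabla^*$ given by $F(gx_0)=\tilde b(g)$ satisfies, for all $x\in V$ and any $x_1$ adjacent to $x_0$, $$\|F(x)\|^2=A\,d(x,x_0)-B+B\,q^{-d(x,x_0)},\quad A=\frac{(q+1)\|F(x_1)\|^2}{q-1},\quad B=\frac{2q\|F(x_1)\|^2}{(q-1)^2}.$$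
   Context: $\mathbb{E}$ is the set of oriented edges; an oriented edge $e$ has source $e_-$, range $e_+$ and reverse $\overline e$. $\ell^2_{\mathrm{alt}}(\mathbb{E})$ is the real Hilbert space of square-summable $\xi:\mathbb{E}\to\mathbb{R}$ with $\xi(\overline e)=-\xi(e)$, with inner product $\langle\xi,\eta\rangle=\frac12\sum_{e\in\mathbb{E}}\xi(e)\eta(e)$. $\ell^2(V,\deg)$ is the space of square-summable functions on $V$ with $(f,g)=\sum_{x}f(x)g(x)\deg(x)$. The gradient $\nabla:\ell^2(V,\deg)\to\ell^2_{\mathrm{alt}}(\mathbb{E})$ is $(\nabla f)(e)=f(e_+)-f(e_-)$, and its adjoint is $(\nabla^*u)(x)=\frac1{\deg(x)}\sum_{y\sim x}u(y,x)$. $Q$ is the orthogonal projection of $\ell^2_{\mathrm{alt}}(\mathbb{E})$ onto the (closed) subspace $\mathrm{im}\,\nabla=(\ker\nabla^* )^\perp$. For $x,y\in V$, $\chi_{x\to y}(e)$ equals $1$ if $e$ lies on the geodesic $[x,y]$ and points from $x$ to $y$, $-1$ if $e$ lies on $[x,y]$ and points from $y$ to $x$, and $0$ otherwise. $G$ acts on $\ell^2_{\mathrm{alt}}(\mathbb{E})$ by the orthogonal representation $\pi$ induced by its action on $\mathbb{E}$; the Haagerup cocycle is $g\mapsto\chi_{x_0\to gx_0}$, which is a cocycle for $\pi$ (i.e. $b(gh)=\pi(g)b(h)+b(g)$). $G$ acts on $\ker\nabla^*$ by the affine isometries $v\mapsto\pi(g)v+\tilde b(g)$, and equivariance of $F$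 refers to this action. A cocycle $b$ is proper if $\{g\in G:\|b(g)\|\le R\}$ is relatively compact for every $R$. $\mathrm{Aut}(\mathcal{T}_{q+1})$ carries the topology of pointwise convergence on vertices, and the boundary is the space of ends. *)

theory Defs
  imports
    "Graph_Theory.Digraph_Component"
    "HOL-Algebra.Bij"
    "HOL-Analysis.Analysis"
begin

section \<open>Regular trees\<close>

text \<open>
  An unoriented simple graph is a symmetric loop-free digraph, so that \<open>parcs T\<close> is the set of
  oriented edges: \<open>e = (x, y)\<close> has source \<open>fst e\<close>, range \<open>snd e\<close> and reverse \<open>prod.swap e\<close>.
  In this encoding every edge yields a directed cycle of length 2, so the library predicates
  \<open>forest\<close> and \<open>tree\<close> do not apply; the cycles of the unoriented graph are those of length at
  least 3. By symmetry of the arcs, \<open>strongly_connected\<close> is ordinary connectedness, and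
  \<open>out_degree\<close> is the degree.
\<close>

definition regular_tree :: "nat \<Rightarrow> 'v pair_pre_digraph \<Rightarrow> bool" where
  "regular_tree d T \<longleftrightarrow>
     pair_bidirected_digraph T \<and>
     strongly_connected (with_proj T) \<and>
     \<not> (\<exists>p. pre_digraph.cycle (with_proj T) p \<and> 3 \<le> length p) \<and>
     (\<forall>x\<in>pverts T. out_degree (with_proj T) x = d)"

definition deg :: "'v pair_pre_digraph \<Rightarrow> 'v \<Rightarrow> real" where
  "deg T x = real (out_degree (with_proj T) x)"

definition gdist :: "'v pair_pre_digraph \<Rightarrow> 'v \<Rightarrow> 'v \<Rightarrow> nat" where
  "gdist T x y = (INF p\<in>{p. pre_digraph.awalk (with_proj T) x p y}. length p)"

text \<open>The geodesic \<open>[x, y]\<close> as its list of edges, each oriented from \<open>x\<close> towards \<open>y\<close>.\<close>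

definition geodesic :: "'v pair_pre_digraph \<Rightarrow> 'v \<Rightarrow> 'v \<Rightarrow> ('v \<times> 'v) list" where
  "geodesic T x y =
     (THE p. pre_digraph.awalk (with_proj T) x p y \<and> length p = gdist T x y)"

section \<open>Automorphisms and ends\<close>

definition aut_group :: "'v pair_pre_digraph \<Rightarrow> ('v \<Rightarrow> 'v) monoid" where
  "aut_group T = (BijGroup (pverts T))\<lparr>carrier :=
     {g \<in> Bij (pverts T). \<forall>x\<in>pverts T. \<forall>y\<in>pverts T.
        (g x, g y) \<in> parcs T \<longleftrightarrow> (x, y) \<in> parcs T}\<rparr>"

definition aut_top :: "'v pair_pre_digraph \<Rightarrow> ('v \<Rightarrow> 'v) topology" where
  "aut_top T =
     subtopology (product_topology (\<lambda>_. discrete_topology (pverts T)) (pverts T))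
       (carrier (aut_group T))"

definition rays :: "'v pair_pre_digraph \<Rightarrow> (nat \<Rightarrow> 'v) set" where
  "rays T = {r. inj r \<and> (\<forall>n. (r n, r (Suc n)) \<in> parcs T)}"

definition cofinal :: "'v pair_pre_digraph \<Rightarrow> ((nat \<Rightarrow> 'v) \<times> (nat \<Rightarrow> 'v)) set" where
  "cofinal T = {(r, s). r \<in> rays T \<and> s \<in> rays T \<and> (\<exists>m n. \<forall>k. r (m + k) = s (n + k))}"

definition ends :: "'v pair_pre_digraph \<Rightarrow> (nat \<Rightarrow> 'v) set set" where
  "ends T = rays T // cofinal T"

definition vertex_transitive :: "'v pair_pre_digraph \<Rightarrow> ('v \<Rightarrow> 'v) set \<Rightarrow> bool" where
  "vertex_transitive T G \<longleftrightarrow> (\<forall>x\<in>pverts T. \<forall>y\<in>pverts T. \<exists>g\<in>G. g x = y)"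

definition boundary_transitive :: "'v pair_pre_digraph \<Rightarrow> ('v \<Rightarrow> 'v) set \<Rightarrow> bool" where
  "boundary_transitive T G \<longleftrightarrow>
     (\<forall>\<omega>\<in>ends T. \<forall>\<eta>\<in>ends T. \<exists>g\<in>G. (\<lambda>r. g \<circ> r) ` \<omega> = \<eta>)"

section \<open>The spaces \<open>\<ell>\<^sup>2(V, deg)\<close> and \<open>\<ell>\<^sup>2\<^sub>a\<^sub>l\<^sub>t(E)\<close>\<close>

text \<open>
  Functions on vertices and on oriented edges are represented by functions on the whole type that
  vanish off \<open>pverts T\<close>, respectively off \<open>parcs T\<close>.
\<close>

definition ell2_vert :: "'v pair_pre_digraph \<Rightarrow> ('v \<Rightarrow> real) set" where
  "ell2_vert T =
     {f. (\<forall>x. x \<notin> pverts T \<longrightarrow> f x = 0) \<and> (\<lambda>x. (f x)\<^sup>2 * deg T x) summable_on pverts T}"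

definition ell2_alt :: "'v pair_pre_digraph \<Rightarrow> ('v \<times> 'v \<Rightarrow> real) set" where
  "ell2_alt T =
     {u. (\<forall>e. e \<notin> parcs T \<longrightarrow> u e = 0) \<and>
         (\<forall>e\<in>parcs T. u (prod.swap e) = - u e) \<and>
         (\<lambda>e. (u e)\<^sup>2) summable_on parcs T}"

definition edge_inner ::
    "'v pair_pre_digraph \<Rightarrow> ('v \<times> 'v \<Rightarrow> real) \<Rightarrow> ('v \<times> 'v \<Rightarrow> real) \<Rightarrow> real" where
  "edge_inner T u v = (1 / 2) * (\<Sum>\<^sub>\<infinity>e\<in>parcs T. u e * v e)"

definition edge_norm :: "'v pair_pre_digraph \<Rightarrow> ('v \<times> 'v \<Rightarrow> real) \<Rightarrow> real" where
  "edge_norm T u = sqrt (edge_inner T u u)"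

definition grad :: "'v pair_pre_digraph \<Rightarrow> ('v \<Rightarrow> real) \<Rightarrow> ('v \<times> 'v \<Rightarrow> real)" where
  "grad T f = (\<lambda>e. if e \<in> parcs T then f (snd e) - f (fst e) else 0)"

definition grad_adj :: "'v pair_pre_digraph \<Rightarrow> ('v \<times> 'v \<Rightarrow> real) \<Rightarrow> ('v \<Rightarrow> real)" where
  "grad_adj T u = (\<lambda>x. (1 / deg T x) * (\<Sum>y | (y, x) \<in> parcs T. u (y, x)))"

definition im_grad :: "'v pair_pre_digraph \<Rightarrow> ('v \<times> 'v \<Rightarrow> real) set" where
  "im_grad T = grad T ` ell2_vert T"

definition ker_grad_adj :: "'v pair_pre_digraph \<Rightarrow> ('v \<times> 'v \<Rightarrow> real) set" where
  "ker_grad_adj T = {u \<in> ell2_alt T. \<forall>x\<in>pverts T. grad_adj T u x = 0}"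

text \<open>
  The orthogonal projection of \<open>u\<close> onto a subspace \<open>S\<close> of \<open>ell2_alt T\<close>; it exists for every
  \<open>u\<close> in \<open>ell2_alt T\<close> exactly when \<open>S\<close> is closed.
\<close>

definition orth_proj ::
    "'v pair_pre_digraph \<Rightarrow> ('v \<times> 'v \<Rightarrow> real) set \<Rightarrow> ('v \<times> 'v \<Rightarrow> real) \<Rightarrow> ('v \<times> 'v \<Rightarrow> real)" where
  "orth_proj T S u = (THE p. p \<in> S \<and> (\<forall>s\<in>S. edge_inner T (\<lambda>e. u e - p e) s = 0))"

section \<open>Cocycles\<close>

definition edge_rep ::
    "'v pair_pre_digraph \<Rightarrow> ('v \<Rightarrow> 'v) \<Rightarrow> ('v \<times> 'v \<Rightarrow> real) \<Rightarrow> ('v \<times> 'v \<Rightarrow> real)" where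
  "edge_rep T g u =
     (\<lambda>e. if e \<in> parcs T
          then u (inv_into (pverts T) g (fst e), inv_into (pverts T) g (snd e)) else 0)"

text \<open>Cocycles for the restriction of \<open>edge_rep T\<close> to a \<open>G\<close>-invariant subspace \<open>W\<close>.\<close>

definition is_cocycle ::
    "'v pair_pre_digraph \<Rightarrow> ('v \<Rightarrow> 'v) set \<Rightarrow> ('v \<times> 'v \<Rightarrow> real) set
      \<Rightarrow> (('v \<Rightarrow> 'v) \<Rightarrow> ('v \<times> 'v \<Rightarrow> real)) \<Rightarrow> bool" where
  "is_cocycle T G W b \<longleftrightarrow>
     (\<forall>g\<in>G. \<forall>u\<in>W. edge_rep T g u \<in> W) \<and>
     b \<in> G \<rightarrow> W \<and>
     (\<forall>g\<in>G. \<forall>h\<in>G. b (g \<otimes>\<^bsub>aut_group T\<^esub> h) = (\<lambda>e. edge_rep T g (b h) e + b g e))"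

definition is_proper ::
    "'v pair_pre_digraph \<Rightarrow> ('v \<Rightarrow> 'v) set \<Rightarrow> (('v \<Rightarrow> 'v) \<Rightarrow> ('v \<times> 'v \<Rightarrow> real)) \<Rightarrow> bool" where
  "is_proper T G b \<longleftrightarrow>
     (\<forall>R::real. compactin (subtopology (aut_top T) G)
        (subtopology (aut_top T) G closure_of {g \<in> G. edge_norm T (b g) \<le> R}))"

definition chi :: "'v pair_pre_digraph \<Rightarrow> 'v \<Rightarrow> 'v \<Rightarrow> ('v \<times> 'v \<Rightarrow> real)" where
  "chi T x y =
     (\<lambda>e. if e \<in> set (geodesic T x y) then 1
          else if prod.swap e \<in> set (geodesic T x y) then - 1 else 0)"

definition harmonic_cocycle ::
    "'v pair_pre_digraph \<Rightarrow> 'v \<Rightarrow> ('v \<Rightarrow> 'v) \<Rightarrow> ('v \<times> 'v \<Rightarrow> real)" where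
  "harmonic_cocycle T x0 g =
     (\<lambda>e. chi T x0 (g x0) e - orth_proj T (im_grad T) (chi T x0 (g x0)) e)"

end

theory Submission
  imports Defs
begin

text \<open>
  In a tree the reduced walks, those that never backtrack, are exactly the geodesics
  (\<open>reduced_walk_unique\<close>, \<open>geodesic_eqI\<close>). So along every edge the distance \<open>d\<^sub>z\<close> from a vertex \<open>z\<close>
  changes by exactly 1, each vertex other than \<open>z\<close> has exactly one neighbour closer to \<open>z\<close>, and
  \<open>\<chi>\<^bsub>x\<rightarrow>y\<^esub> = \<nabla>((d\<^sub>x - d\<^sub>y) / 2)\<close> (\<open>chi_eq_grad_gdist\<close>). For \<open>x \<noteq> y\<close> the function
  under this gradient is not square-summable, not even after adding a constant, so \<open>\<chi>\<^bsub>x\<rightarrow>y\<^esub>\<close> has a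
  nonzero component orthogonal to \<open>im \<nabla>\<close>.
  
  The function \<open>q / (q\<^sup>2 - 1) \<cdot> q\<^bsup>-d\<^sub>z\<^esup>\<close> is square-summable, since spheres grow more slowly than
  \<open>q\<^bsup>2n\<^esup>\<close>, and it is harmonic except at \<open>z\<close>. Its Laplacian at \<open>z\<close> compensates the exceptional value that
  the Laplacian of \<open>d\<^sub>z / 2\<close> has there: with \<open>h(n) = n / 2 + q / (q\<^sup>2 - 1) \<cdot> q\<^bsup>-n\<^esup>\<close>, the Laplacian of
  \<open>h \<circ> d\<^sub>z\<close> is one constant on the whole tree, independent of \<open>z\<close> (\<open>laplacian_potential\<close>). Therefore
  \<open>\<omega>\<^bsub>x,y\<^esub> = \<nabla>(h \<circ> d\<^sub>x - h \<circ> d\<^sub>y)\<close> lies in \<open>ker \<nabla>\<^sup>*\<close>. It differs from \<open>\<chi>\<^bsub>x\<rightarrow>y\<^esub>\<close> by the gradient of a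
  square-summable function, so it is the projection of \<open>\<chi>\<^bsub>x\<rightarrow>y\<^esub>\<close> onto \<open>ker \<nabla>\<^sup>*\<close>
  (\<open>harmonic_cocycle_eq\<close>).
  
  All claims are read off from \<open>\<omega>\<close>. It is additive, \<open>\<omega>\<^bsub>x,z\<^esub> = \<omega>\<^bsub>x,y\<^esub> + \<omega>\<^bsub>y,z\<^esub>\<close>, and it is carried by an
  automorphism \<open>g\<close> to \<open>\<omega>\<^bsub>gx,gy\<^esub>\<close>; these are the cocycle identity and the equivariance of \<open>F\<close>. By
  orthogonality \<open>\<parallel>\<omega>\<^bsub>x,y\<^esub>\<parallel>\<^sup>2\<close> is the inner product of \<open>\<omega>\<^bsub>x,y\<^esub>\<close> with \<open>\<chi>\<^bsub>x\<rightarrow>y\<^esub>\<close>, a sum along the geodesic that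
  telescopes to \<open>2 (h(d(x, y)) - h(0))\<close> (\<open>edge_norm_harmonic_form\<close>); this is the norm formula. It
  bounds \<open>|g|\<close> in terms of the norm, and automorphisms that move \<open>x\<^sub>0\<close> by a bounded distance form a
  compact set by Tychonoff's theorem (\<open>compactin_bounded_auts\<close>), so the cocycle is proper.
\<close>

section \<open>Reduced walks in a tree\<close>

text \<open>
  Here \<open>cycle\<close> allows the closed walks of length 2 that run along an edge and back, so
  acyclicity is the absence of cycles of length at least 3.
\<close>

locale bidirected_tree = pair_bidirected_digraph T for T :: "'v pair_pre_digraph" +
  assumes tree_connected: "strongly_connected (with_proj T)"
    and no_long_cycle: "\<not> (\<exists>p. cycle p \<and> 3 \<le> length p)"

abbreviation reduced :: "('v \<times> 'v) list \<Rightarrow> bool" where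
  "reduced \<equiv> successively (\<lambda>e f. f \<noteq> prod.swap e)"

lemma reduced_rev_path: "reduced (rev_path p) \<longleftrightarrow> reduced p"
proof -
  have eq: "rev_path p = map prod.swap (rev p)"
    by (induction p) (auto simp: prod.swap_def)
  show ?thesis
    unfolding eq successively_map successively_rev by (intro successively_cong) auto
qed

lemma not_reduced_backtrack:
  assumes "\<not> reduced p"
  obtains q e r where "p = q @ e # prod.swap e # r"
  using assms
proof (induction p arbitrary: thesis rule: induct_list012)
  case (3 e f p)
  show ?case
  proof (cases "f = prod.swap e")
    case True
    then show ?thesis
      using "3.prems"(1)[of "[]" e p] by simp
  next
    case False
    then have "\<not> reduced (f # p)"
      using "3.prems"(2) by simp
    then obtain q e' r where "f # p = q @ e' # prod.swap e' # r"
      using "3.IH"(2) by blast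
    then show ?thesis
      using "3.prems"(1)[of "e # q" e' r] by simp
  qed
qed simp_all

lemma reduced_append_overlap:
  assumes "reduced (p @ [e])" "reduced (e # r)"
  shows "reduced (p @ e # r)"
  using assms by (cases r) (auto simp: successively_append_iff)

context bidirected_tree
begin

text \<open>
  A closed walk that is not itself a cycle contains a shorter closed walk, which is reduced because
  it is a contiguous piece. In the end one reaches a cycle, which has length at most 2; length 1 is
  a loop and length 2 is a backtrack.
\<close>

lemma reduced_closed_walk_Nil:
  assumes "awalk u p u" "reduced p"
  shows "p = []"
  using assms
proof (induction "length p" arbitrary: u p rule: less_induct)
  case less
  show ?case
  proof (rule ccontr)
    assume ne: "p \<noteq> []"
    show False
    proof (cases "distinct (tl (awalk_verts u p))")
      case True
      then have "cycle p"
        unfolding cycle_def awalk_verts_with_proj_eq using less.prems ne by blast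
      then have "length p < 3"
        using no_long_cycle by (meson not_less)
      then consider e where "p = [e]" | e f where "p = [e, f]"
        using ne by (cases p rule: list_exhaust_NSC) auto
      then show False
      proof cases
        case 1
        then show False
          using less.prems by (auto simp: awalk_simps dest: no_loops)
      next
        case 2
        then show False
          using less.prems by (auto simp: awalk_simps prod_eq_iff)
      qed
    next
      case False
      then obtain e es where p: "p = e # es"
        by (cases p) auto
      with False less.prems have "awalk (snd e) es u" "\<not> distinct (awalk_verts (snd e) es)"
        by (auto simp: awalk_Cons_iff)
      from awalk_not_distinct_decomp[OF this] obtain q r s w
        where es: "es = q @ r @ s" and r: "0 < length r" "awalk w r w"
        by auto
      have "reduced r"
        using less.prems(2) unfolding p es by (auto simp: successively_append_iff successively_Cons)
      moreover have "length r < length p"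
        unfolding p es by simp
      ultimately have "r = []"
        using less.hyps r(2) by blast
      with r(1) show False by simp
    qed
  qed
qed

text \<open>
  Two reduced walks with the same ends that arrive through different edges would give, by going
  along one and back along the other, a nonempty reduced closed walk. So the last edges agree and
  can be removed.
\<close>

lemma reduced_walk_unique:
  assumes "awalk u p v" "awalk u q v" "reduced p" "reduced q"
  shows "p = q"
  using assms
proof (induction p arbitrary: q v rule: rev_induct)
  case Nil
  then have "awalk u q u"
    by (auto simp: awalk_Nil_iff)
  then show ?case
    using reduced_closed_walk_Nil Nil.prems(4) by metis
next
  case (snoc e p)
  show ?case
  proof (cases q rule: rev_cases)
    case Nil
    with snoc.prems(1,2) have "awalk u (p @ [e]) u"
      by (auto simp: awalk_Nil_iff)
    with reduced_closed_walk_Nil snoc.prems(3) show ?thesis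
      by blast
  next
    case (snoc q' f)
    have walks: "awalk u p (fst e)" "awalk u q' (fst f)" "snd e = v" "snd f = v"
      using \<open>awalk u (p @ [e]) v\<close> \<open>awalk u q v\<close> unfolding snoc by (auto simp: awalk_simps)
    show ?thesis
    proof (cases "e = f")
      case True
      then show ?thesis
        using snoc snoc.IH[of "fst e" q'] walks snoc.prems(3,4) by (auto simp: successively_append_iff)
    next
      case False
      then have "f \<noteq> e" by simp
      \<comment> \<open>the joint is no backtrack because the last edges differ\<close>
      have "reduced ((p @ [e]) @ rev_path q)"
        using snoc.prems(3,4) False walks(3,4) unfolding successively_append_iff reduced_rev_path
        by (auto simp: snoc prod_eq_iff)
      moreover have "awalk u ((p @ [e]) @ rev_path q) u"
        using snoc.prems(1,2) awalk_appendI awalk_rev_path' by blast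
      ultimately show ?thesis
        using reduced_closed_walk_Nil by blast
    qed
  qed
qed

lemma gdist_le_length: "awalk x p y \<Longrightarrow> gdist T x y \<le> length p"
  unfolding gdist_def by (rule cINF_lower) auto

lemma shortest_walk_exists:
  assumes "x \<in> pverts T" "y \<in> pverts T"
  obtains p where "awalk x p y" "length p = gdist T x y"
proof -
  have "x \<rightarrow>\<^sup>*\<^bsub>with_proj T\<^esub> y"
    using tree_connected assms by (auto simp: strongly_connected_def)
  then have "{p. awalk x p y} \<noteq> {}"
    by (auto simp: reachable_awalk)
  then have "length ` {p. awalk x p y} \<noteq> {}"
    by blast
  from Inf_nat_def1[OF this] show ?thesis
    using that unfolding gdist_def by auto
qed

lemma shortest_walk_reduced:
  assumes "awalk x p y" "length p = gdist T x y"
  shows "reduced p"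
proof (rule ccontr)
  assume "\<not> reduced p"
  then obtain q e r where p: "p = q @ e # prod.swap e # r"
    by (rule not_reduced_backtrack)
  with assms(1) have "awalk x (q @ r) y"
    by (auto simp: awalk_simps)
  from gdist_le_length[OF this] assms(2) p show False
    by simp
qed

text \<open>
  Shortest walks are reduced, so by uniqueness every reduced walk is the geodesic. Geodesics are
  from now on recognized by the local condition of being reduced.
\<close>

lemma geodesic_eqI:
  assumes "awalk x p y" "reduced p"
  shows "geodesic T x y = p" "gdist T x y = length p"
proof -
  have "x \<in> pverts T" "y \<in> pverts T"
    using assms(1) by (auto simp: awalk_hd_in_verts awalk_last_in_verts)
  then obtain q where q: "awalk x q y" "length q = gdist T x y"
    by (rule shortest_walk_exists)
  have "q = p"
    by (rule reduced_walk_unique[OF q(1) assms(1) shortest_walk_reduced[OF q] assms(2)])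
  with q(2) show len: "gdist T x y = length p"
    by (simp only:)
  show "geodesic T x y = p"
    unfolding geodesic_def
  proof (rule the_equality)
    show "awalk x p y \<and> length p = gdist T x y"
      using assms(1) len by simp
    show "r = p" if "awalk x r y \<and> length r = gdist T x y" for r
      using reduced_walk_unique[of x r y p] shortest_walk_reduced[of x r y] that assms by simp
  qed
qed

lemma geodesic_walk:
  assumes "x \<in> pverts T" "y \<in> pverts T"
  shows "awalk x (geodesic T x y) y" "reduced (geodesic T x y)"
    "length (geodesic T x y) = gdist T x y"
proof -
  obtain q where q: "awalk x q y" "length q = gdist T x y"
    by (rule shortest_walk_exists[OF assms])
  note r = shortest_walk_reduced[OF q]
  show "awalk x (geodesic T x y) y" "reduced (geodesic T x y)"
    "length (geodesic T x y) = gdist T x y"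
    unfolding geodesic_eqI(1)[OF q(1) r] by (fact q r)+
qed

lemma gdist_self: "x \<in> pverts T \<Longrightarrow> gdist T x x = 0"
  using geodesic_eqI(2)[of x "[]" x] by (simp add: awalk_Nil_iff)

lemma gdist_eq_0_iff:
  assumes "x \<in> pverts T" "y \<in> pverts T"
  shows "gdist T x y = 0 \<longleftrightarrow> x = y"
proof
  assume "gdist T x y = 0"
  with geodesic_walk(3)[OF assms] have "geodesic T x y = []"
    by simp
  with geodesic_walk(1)[OF assms] show "x = y"
    by (simp add: awalk_Nil_iff)
qed (use gdist_self assms in simp)

lemma gdist_sym:
  assumes "x \<in> pverts T" "y \<in> pverts T"
  shows "gdist T x y = gdist T y x"
proof -
  have len: "length (rev_path p) = length p" for p :: "('v \<times> 'v) list"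
    by (induction p) auto
  have "awalk y (rev_path (geodesic T x y)) x" "reduced (rev_path (geodesic T x y))"
    using geodesic_walk[OF assms] by (simp_all add: reduced_rev_path)
  from geodesic_eqI(2)[OF this] show ?thesis
    using geodesic_walk(3)[OF assms] len by simp
qed

lemma gdist_triangle:
  assumes "x \<in> pverts T" "y \<in> pverts T" "z \<in> pverts T"
  shows "gdist T x z \<le> gdist T x y + gdist T y z"
proof -
  have "awalk x (geodesic T x y @ geodesic T y z) z"
    using awalk_appendI geodesic_walk(1) assms by blast
  from gdist_le_length[OF this] show ?thesis
    using geodesic_walk(3) assms by simp
qed

text \<open>
  The geodesic to \<open>v\<close> either ends with the edge from \<open>w\<close>, and then removing that edge gives the
  geodesic to \<open>w\<close>, or it can be prolonged by the edge to \<open>w\<close> without backtracking.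
\<close>

lemma geodesic_step:
  assumes "z \<in> pverts T" "(v, w) \<in> parcs T"
  shows "geodesic T z w = geodesic T z v @ [(v, w)] \<or> geodesic T z v = geodesic T z w @ [(w, v)]"
proof -
  have v: "v \<in> pverts T"
    using assms(2) wellformed by force
  note g = geodesic_walk[OF assms(1) v]
  show ?thesis
  proof (cases "geodesic T z v \<noteq> [] \<and> last (geodesic T z v) = (w, v)")
    case True
    then obtain p where p: "geodesic T z v = p @ [(w, v)]"
      by (metis append_butlast_last_id)
    with g have "awalk z p w" "reduced p"
      by (auto simp: awalk_simps successively_append_iff)
    with p geodesic_eqI(1) show ?thesis by metis
  next
    case False
    with g(2) have "reduced (geodesic T z v @ [(v, w)])"
      by (auto simp: successively_append_iff prod.swap_def prod_eq_iff)
    moreover have "awalk z (geodesic T z v @ [(v, w)]) w"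
      by (rule awalk_appendI[OF g(1)])
        (use assms(2) in_arcsD1[OF assms(2)] in_arcsD2[OF assms(2)] in \<open>simp add: awalk_simps\<close>)
    ultimately show ?thesis
      using geodesic_eqI(1) by blast
  qed
qed

lemma gdist_neighbour:
  assumes "z \<in> pverts T" "(v, w) \<in> parcs T"
  shows "gdist T z w = gdist T z v + 1 \<or> gdist T z v = gdist T z w + 1"
proof -
  have "v \<in> pverts T" "w \<in> pverts T"
    by (fact in_arcsD1[OF assms(2)], fact in_arcsD2[OF assms(2)])
  then show ?thesis
    using geodesic_step[OF assms] geodesic_walk(3)[OF assms(1), of v] geodesic_walk(3)[OF assms(1), of w]
    by (metis length_append_singleton Suc_eq_plus1)
qed

lemma geodesic_snoc:
  assumes "z \<in> pverts T" "(v, w) \<in> parcs T" "gdist T z w = gdist T z v + 1"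
  shows "geodesic T z w = geodesic T z v @ [(v, w)]"
proof -
  have "v \<in> pverts T" "w \<in> pverts T"
    by (fact in_arcsD1[OF assms(2)], fact in_arcsD2[OF assms(2)])
  then have "length (geodesic T z w) = length (geodesic T z v) + 1"
    using assms geodesic_walk(3)[OF assms(1)] by simp
  with geodesic_step[OF assms(1,2)] show ?thesis
    by auto
qed

text \<open>
  The closer neighbour is the one through which the geodesic from \<open>z\<close> arrives at \<open>v\<close>. That it is
  unique is what makes \<open>v \<mapsto> h (gdist T z v)\<close> accessible to the Laplacian.
\<close>

lemma closer_neighbour:
  assumes "z \<in> pverts T" "v \<in> pverts T" "z \<noteq> v"
  shows "\<exists>!w. (w, v) \<in> parcs T \<and> gdist T z v = gdist T z w + 1"
proof -
  note g = geodesic_walk[OF assms(1,2)]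
  have "geodesic T z v \<noteq> []"
    using g(3) gdist_eq_0_iff[OF assms(1,2)] assms(3) by (metis list.size(3))
  then obtain p e where pe: "geodesic T z v = p @ [e]"
    by (metis append_butlast_last_id)
  have e: "e = (fst e, v)" "awalk z p (fst e)" "e \<in> parcs T"
    using g(1) unfolding pe by (auto simp: awalk_simps)
  have "reduced p"
    using g(2) unfolding pe by (auto simp: successively_append_iff)
  from geodesic_eqI(2)[OF e(2) this] have "gdist T z v = gdist T z (fst e) + 1"
    using g(3) pe by simp
  moreover have "w = fst e" if "(w, v) \<in> parcs T" "gdist T z v = gdist T z w + 1" for w
    using geodesic_snoc[OF assms(1) that] pe by simp
  ultimately show ?thesis
    using e(1,3) by metis
qed

text \<open>
  From right to left, the geodesic from \<open>x\<close> to \<open>a\<close>, the edge \<open>(a, b)\<close> and the geodesic from \<open>b\<close> to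
  \<open>y\<close> are concatenated. Both joints lie in a reduced walk, because the edge prolongs the first
  geodesic and its reverse prolongs the geodesic from \<open>y\<close> to \<open>b\<close>.
\<close>

lemma geodesic_edge_iff:
  assumes "x \<in> pverts T" "y \<in> pverts T" "(a, b) \<in> parcs T"
  shows "(a, b) \<in> set (geodesic T x y) \<longleftrightarrow>
    gdist T x b = gdist T x a + 1 \<and> gdist T y a = gdist T y b + 1"
proof
  note g = geodesic_walk[OF assms(1,2)]
  have ab: "a \<in> pverts T" "b \<in> pverts T"
    by (fact in_arcsD1[OF assms(3)], fact in_arcsD2[OF assms(3)])
  assume "(a, b) \<in> set (geodesic T x y)"
  then obtain p r where pr: "geodesic T x y = p @ (a, b) # r"
    by (meson split_list)
  have "awalk x p a" "awalk x (p @ [(a, b)]) b" "awalk b r y" "awalk a ((a, b) # r) y"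
    using g(1) unfolding pr by (auto simp: awalk_simps)
  moreover have "reduced p" "reduced (p @ [(a, b)])" "reduced r" "reduced ((a, b) # r)"
    using g(2) unfolding pr by (auto simp: successively_append_iff successively_Cons)
  ultimately have "gdist T x b = gdist T x a + 1" "gdist T a y = gdist T b y + 1"
    using geodesic_eqI(2)[of x p a] geodesic_eqI(2)[of x "p @ [(a, b)]" b]
      geodesic_eqI(2)[of b r y] geodesic_eqI(2)[of a "(a, b) # r" y] by simp_all
  then show "gdist T x b = gdist T x a + 1 \<and> gdist T y a = gdist T y b + 1"
    using gdist_sym[OF ab(1) assms(2)] gdist_sym[OF ab(2) assms(2)] by simp
next
  have ab: "a \<in> pverts T" "b \<in> pverts T"
    by (fact in_arcsD1[OF assms(3)], fact in_arcsD2[OF assms(3)])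
  assume d: "gdist T x b = gdist T x a + 1 \<and> gdist T y a = gdist T y b + 1"
  have xb: "geodesic T x b = geodesic T x a @ [(a, b)]"
    using geodesic_snoc[OF assms(1,3)] d by simp
  have ya: "geodesic T y a = geodesic T y b @ [(b, a)]"
    using geodesic_snoc[OF assms(2) arcs_symmetric[OF assms(3)]] d by simp
  define r where "r = rev_path (geodesic T y b)"
  have "rev_path (geodesic T y a) = (a, b) # r"
    unfolding ya r_def by simp
  then have r: "awalk a ((a, b) # r) y" "reduced ((a, b) # r)"
    using awalk_rev_path'[OF geodesic_walk(1)[OF assms(2) ab(1)]]
      reduced_rev_path[of "geodesic T y a"] geodesic_walk(2)[OF assms(2) ab(1)] by simp_all
  have "awalk x (geodesic T x a @ (a, b) # r) y"
    by (rule awalk_appendI[OF geodesic_walk(1)[OF assms(1) ab(1)] r(1)])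
  moreover have "reduced (geodesic T x a @ (a, b) # r)"
    by (rule reduced_append_overlap[OF _ r(2)])
      (use geodesic_walk(2)[OF assms(1) ab(2)] xb in simp)
  ultimately have "geodesic T x y = geodesic T x a @ (a, b) # r"
    by (rule geodesic_eqI(1))
  then show "(a, b) \<in> set (geodesic T x y)"
    by simp
qed

lemma geodesic_subset_arcs:
  assumes "x \<in> pverts T" "y \<in> pverts T"
  shows "set (geodesic T x y) \<subseteq> parcs T"
  using geodesic_walk(1)[OF assms] by (auto simp: awalk_def)

lemma swap_in_parcs_iff: "prod.swap e \<in> parcs T \<longleftrightarrow> e \<in> parcs T"
  by (cases e) (auto intro: arcs_symmetric)

text \<open>
  Both distances change by exactly 1 along an edge; their changes cancel unless the edge lies on
  \<open>[x, y]\<close>, where they have opposite signs. This formula replaces the geodesic by distance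
  functions, for which additivity in \<open>(x, y)\<close> and equivariance are evident.
\<close>

lemma chi_eq_grad_gdist:
  assumes "x \<in> pverts T" "y \<in> pverts T"
  shows "chi T x y = grad T (\<lambda>v. (real (gdist T x v) - real (gdist T y v)) / 2)"
proof
  fix e :: "'v \<times> 'v"
  obtain a b where e: "e = (a, b)" by fastforce
  show "chi T x y e = grad T (\<lambda>v. (real (gdist T x v) - real (gdist T y v)) / 2) e"
  proof (cases "e \<in> parcs T")
    case True
    then have ab: "(a, b) \<in> parcs T" and ba: "(b, a) \<in> parcs T"
      unfolding e by (auto intro: arcs_symmetric)
    have "chi T x y e =
      (if gdist T x b = gdist T x a + 1 \<and> gdist T y a = gdist T y b + 1 then 1
       else if gdist T x a = gdist T x b + 1 \<and> gdist T y b = gdist T y a + 1 then - 1 else 0)"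
      by (simp add: chi_def e geodesic_edge_iff[OF assms ab] geodesic_edge_iff[OF assms ba])
    also have "\<dots> = ((real (gdist T x b) - real (gdist T y b)) - (real (gdist T x a) - real (gdist T y a))) / 2"
      using gdist_neighbour[OF assms(1) ab] gdist_neighbour[OF assms(2) ab]
      by (elim disjE) simp_all
    finally show ?thesis
      using ab by (simp add: grad_def e diff_divide_distrib)
  next
    case False
    then have "e \<notin> set (geodesic T x y)" "prod.swap e \<notin> set (geodesic T x y)"
      using geodesic_subset_arcs[OF assms] swap_in_parcs_iff[of e] by blast+
    with False show ?thesis
      by (simp add: chi_def grad_def)
  qed
qed

lemma sum_grad_walk: "awalk x p y \<Longrightarrow> sum_list (map (grad T f) p) = f y - f x"
  by (induction p arbitrary: x) (auto simp: awalk_simps grad_def)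

lemma geodesic_distinct:
  assumes "x \<in> pverts T" "y \<in> pverts T"
  shows "distinct (geodesic T x y)"
proof (rule ccontr)
  assume "\<not> distinct (geodesic T x y)"
  then obtain p q r e where pqr: "geodesic T x y = p @ [e] @ q @ [e] @ r"
    using not_distinct_decomp[of "geodesic T x y"] by metis
  note g = geodesic_walk[OF assms]
  have "awalk (fst e) (e # q) (fst e)"
    using g(1) unfolding pqr by (simp add: awalk_simps) metis
  moreover have "reduced (e # q)"
    using g(2) unfolding pqr by (auto simp: successively_append_iff successively_Cons)
  ultimately show False
    using reduced_closed_walk_Nil[of "fst e" "e # q"] by simp
qed

end

section \<open>Square-summable functions on edges and vertices\<close>

lemma summable_on_power2_diff:
  fixes f g :: "'a \<Rightarrow> real"
  assumes "(\<lambda>x. (f x)\<^sup>2) summable_on A" "(\<lambda>x. (g x)\<^sup>2) summable_on A"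
  shows "(\<lambda>x. (f x - g x)\<^sup>2) summable_on A"
proof (rule summable_on_comparison_test)
  show "(\<lambda>x. 2 * (f x)\<^sup>2 + 2 * (g x)\<^sup>2) summable_on A"
    using assms by (intro summable_on_add summable_on_cmult_right)
  show "(f x - g x)\<^sup>2 \<le> 2 * (f x)\<^sup>2 + 2 * (g x)\<^sup>2" for x
    using zero_le_power2[of "f x + g x"] by (simp add: power2_eq_square algebra_simps)
qed simp

lemma summable_on_mult_power2:
  fixes f g :: "'a \<Rightarrow> real"
  assumes "(\<lambda>x. (f x)\<^sup>2) summable_on A" "(\<lambda>x. (g x)\<^sup>2) summable_on A"
  shows "(\<lambda>x. f x * g x) summable_on A"
proof -
  have "(\<lambda>x. norm (f x * f x)) summable_on A" "(\<lambda>x. norm (g x * g x)) summable_on A"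
    using assms by (simp_all add: power2_eq_square)
  then have "(\<lambda>x. norm (f x * g x)) summable_on A"
    by (rule abs_summable_product)
  then show ?thesis
    by (rule summable_on_iff_abs_summable_on_real[THEN iffD2])
qed

lemma infsum_diff:
  fixes f g :: "'a \<Rightarrow> 'b::{topological_ab_group_add,t2_space}"
  assumes "f summable_on A" "g summable_on A"
  shows "infsum (\<lambda>x. f x - g x) A = infsum f A - infsum g A"
proof -
  have "(\<lambda>x. - g x) summable_on A"
    using assms(2) by (simp only: summable_on_uminus)
  from infsum_add[OF assms(1) this] show ?thesis
    by (simp add: infsum_uminus)
qed

lemma ell2_altD:
  assumes "u \<in> ell2_alt T"
  shows "e \<notin> parcs T \<Longrightarrow> u e = 0" "e \<in> parcs T \<Longrightarrow> u (prod.swap e) = - u e"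
    "(\<lambda>e. (u e)\<^sup>2) summable_on parcs T"
proof -
  have u: "(\<forall>e. e \<notin> parcs T \<longrightarrow> u e = 0) \<and> (\<forall>e\<in>parcs T. u (prod.swap e) = - u e) \<and>
      (\<lambda>e. (u e)\<^sup>2) summable_on parcs T"
    using assms unfolding ell2_alt_def by (rule CollectD)
  show "e \<notin> parcs T \<Longrightarrow> u e = 0" "e \<in> parcs T \<Longrightarrow> u (prod.swap e) = - u e"
    "(\<lambda>e. (u e)\<^sup>2) summable_on parcs T"
    using u by blast+
qed

lemma ell2_alt_diff:
  assumes "u \<in> ell2_alt T" "v \<in> ell2_alt T"
  shows "(\<lambda>e. u e - v e) \<in> ell2_alt T"
  using assms summable_on_power2_diff[of u "parcs T" v] by (simp add: ell2_alt_def)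

lemma edge_inner_diff_left:
  assumes "u \<in> ell2_alt T" "v \<in> ell2_alt T" "w \<in> ell2_alt T"
  shows "edge_inner T (\<lambda>e. u e - v e) w = edge_inner T u w - edge_inner T v w"
proof -
  have "(\<lambda>e. u e * w e) summable_on parcs T" "(\<lambda>e. v e * w e) summable_on parcs T"
    using assms by (auto intro!: summable_on_mult_power2 ell2_altD(3))
  then show ?thesis
    unfolding edge_inner_def left_diff_distrib by (subst infsum_diff) (simp_all add: algebra_simps)
qed

lemma edge_inner_commute: "edge_inner T u v = edge_inner T v u"
  by (simp add: edge_inner_def mult.commute)

lemma edge_inner_self_nonneg: "edge_inner T u u \<ge> 0"
  by (simp add: edge_inner_def infsum_nonneg)

lemma edge_inner_self_eq_0:
  assumes "u \<in> ell2_alt T" "edge_inner T u u = 0"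
  shows "u = (\<lambda>e. 0)"
proof
  fix e
  show "u e = 0"
  proof (cases "e \<in> parcs T")
    case True
    have "u e * u e = 0"
      by (rule nonneg_infsum_le_0D[where A = "parcs T" and f = "\<lambda>e. u e * u e"])
        (use assms(2) True ell2_altD(3)[OF assms(1)] in \<open>simp_all add: edge_inner_def power2_eq_square\<close>)
    then show ?thesis by simp
  qed (rule ell2_altD(1)[OF assms(1)])
qed

locale homogeneous_tree = bidirected_tree T for T :: "'v pair_pre_digraph" +
  fixes q :: nat
  assumes q_ge_2: "q \<ge> 2"
    and out_degree_eq: "x \<in> pverts T \<Longrightarrow> out_degree (with_proj T) x = q + 1"
begin

lemma card_neighbours:
  assumes "x \<in> pverts T"
  shows "card {y. (y, x) \<in> parcs T} = q + 1"
proof -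
  have "out_arcs (with_proj T) x = (\<lambda>y. (x, y)) ` {y. (y, x) \<in> parcs T}"
    by (auto simp: out_arcs_def image_iff intro: arcs_symmetric)
  then have "out_degree (with_proj T) x = card {y. (y, x) \<in> parcs T}"
    unfolding out_degree_def by (simp add: card_image inj_on_def)
  then show ?thesis
    using out_degree_eq[OF assms] by simp
qed

lemma finite_neighbours: "x \<in> pverts T \<Longrightarrow> finite {y. (y, x) \<in> parcs T}"
  using card_neighbours by (intro card_ge_0_finite) simp

lemma deg_eq: "x \<in> pverts T \<Longrightarrow> deg T x = real q + 1"
  by (simp add: deg_def out_degree_eq)

lemma parcs_Sigma: "parcs T = (SIGMA x:pverts T. {y. (y, x) \<in> parcs T})"
proof (rule Set.set_eqI)
  fix e
  show "e \<in> parcs T \<longleftrightarrow> e \<in> (SIGMA x:pverts T. {y. (y, x) \<in> parcs T})"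
    using arcs_symmetric[of "fst e" "snd e"] arcs_symmetric[of "snd e" "fst e"] in_arcsD1[of "fst e" "snd e"]
    by (cases e) auto
qed

lemma bij_swap_parcs: "bij_betw prod.swap (parcs T) (parcs T)"
  by (rule bij_betw_byWitness[of _ prod.swap]) (auto intro: arcs_symmetric)

text \<open>
  This crude bound, by the number of walks of length \<open>n\<close>, is enough: the squares of
  \<open>(1 / q) ^ gdist T z v\<close> are summed below, and \<open>(q + 1) / q\<^sup>2 < 1\<close>.
\<close>

lemma sphere_finite_card_le:
  assumes "z \<in> pverts T"
  shows "finite {v \<in> pverts T. gdist T z v = n} \<and> card {v \<in> pverts T. gdist T z v = n} \<le> (q + 1) ^ n"
proof (induction n)
  case 0
  have "{v \<in> pverts T. gdist T z v = 0} = {z}"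
    using gdist_eq_0_iff[OF assms] assms by auto
  then show ?case by simp
next
  case (Suc n)
  let ?S = "\<lambda>n. {v \<in> pverts T. gdist T z v = n}"
  have sub: "?S (Suc n) \<subseteq> (\<Union>v\<in>?S n. {y. (y, v) \<in> parcs T})"
  proof
    fix v
    assume v: "v \<in> ?S (Suc n)"
    then have "z \<noteq> v"
      using gdist_self[OF assms] by auto
    then obtain w where "(w, v) \<in> parcs T" "gdist T z v = gdist T z w + 1"
      using closer_neighbour[OF assms, of v] v by blast
    then show "v \<in> (\<Union>v\<in>?S n. {y. (y, v) \<in> parcs T})"
      using v by (auto intro!: bexI[of _ w] intro: arcs_symmetric in_arcsD1)
  qed
  have fin: "finite (\<Union>v\<in>?S n. {y. (y, v) \<in> parcs T})"
    using Suc finite_neighbours by blast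
  have "card (?S (Suc n)) \<le> (\<Sum>v\<in>?S n. card {y. (y, v) \<in> parcs T})"
    using card_mono[OF fin sub] card_UN_le[of "?S n" "\<lambda>v. {y. (y, v) \<in> parcs T}"] Suc by simp
  also have "\<dots> = card (?S n) * (q + 1)"
    by (simp add: card_neighbours)
  also have "\<dots> \<le> (q + 1) ^ Suc n"
    using mult_le_mono1[of "card (?S n)" "(q + 1) ^ n" "q + 1"] Suc by (simp add: mult.commute)
  finally show ?case
    using finite_subset[OF sub fin] by blast
qed

lemma summable_on_exp_gdist:
  assumes "z \<in> pverts T"
  shows "(\<lambda>v. ((1 / real q) ^ gdist T z v)\<^sup>2) summable_on pverts T"
proof (rule nonneg_bdd_above_summable_on)
  define r where "r = (real q + 1) / (real q)\<^sup>2"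
  have "real q + 1 < (real q)\<^sup>2"
  proof -
    have "2 * real q \<le> real q * real q" and "1 < real q"
      using q_ge_2 by (auto intro: mult_right_mono)
    then show ?thesis
      unfolding power2_eq_square by linarith
  qed
  then have r: "0 \<le> r" "r < 1"
    using q_ge_2 by (auto simp: r_def)
  have "sum (\<lambda>v. ((1 / real q) ^ gdist T z v)\<^sup>2) F \<le> 1 / (1 - r)"
    if F: "F \<subseteq> pverts T" "finite F" for F
  proof -
    obtain N where N: "gdist T z ` F \<subseteq> {..<N}"
      using finite_nat_bounded F(2) by blast
    have "sum (\<lambda>v. ((1 / real q) ^ gdist T z v)\<^sup>2) F =
        (\<Sum>n<N. \<Sum>v\<in>{v \<in> F. gdist T z v = n}. ((1 / real q) ^ gdist T z v)\<^sup>2)"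
      by (rule sum.group[symmetric]) (use F N in auto)
    also have "\<dots> = (\<Sum>n<N. real (card {v \<in> F. gdist T z v = n}) * ((1 / real q) ^ n)\<^sup>2)"
      by simp
    also have "\<dots> \<le> (\<Sum>n<N. (real q + 1) ^ n * ((1 / real q) ^ n)\<^sup>2)"
    proof (intro sum_mono mult_right_mono)
      fix n
      have "card {v \<in> F. gdist T z v = n} \<le> card {v \<in> pverts T. gdist T z v = n}"
        using F sphere_finite_card_le[OF assms] by (intro card_mono) auto
      also have "\<dots> \<le> (q + 1) ^ n"
        using sphere_finite_card_le[OF assms] by blast
      finally show "real (card {v \<in> F. gdist T z v = n}) \<le> (real q + 1) ^ n"
        by (metis of_nat_Suc Suc_eq_plus1 add.commute of_nat_le_iff of_nat_power)
    qed simp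
    also have "\<dots> = (\<Sum>n<N. r ^ n)"
      by (simp add: r_def power_divide power_mult_distrib power2_eq_square power_mult_distrib)
    also have "\<dots> = (1 - r ^ N) / (1 - r)"
      using r sum_gp_strict[of r N] by simp
    also have "\<dots> \<le> 1 / (1 - r)"
      using r by (intro divide_right_mono) auto
    finally show ?thesis .
  qed
  then show "bdd_above (sum (\<lambda>v. ((1 / real q) ^ gdist T z v)\<^sup>2) ` {F. F \<subseteq> pverts T \<and> finite F})"
    by (intro bdd_aboveI2[of _ _ "1 / (1 - r)"]) auto
qed simp

lemma ell2_vert_iff:
  "f \<in> ell2_vert T \<longleftrightarrow> (\<forall>x. x \<notin> pverts T \<longrightarrow> f x = 0) \<and> (\<lambda>x. (f x)\<^sup>2) summable_on pverts T"
proof -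
  have "(\<lambda>x. (f x)\<^sup>2 * deg T x) summable_on pverts T \<longleftrightarrow>
      (\<lambda>x. (f x)\<^sup>2 * (real q + 1)) summable_on pverts T"
    by (rule summable_on_cong) (simp add: deg_eq)
  also have "\<dots> \<longleftrightarrow> (\<lambda>x. (f x)\<^sup>2) summable_on pverts T"
    by (rule summable_on_cmult_left') simp
  finally show ?thesis
    by (simp add: ell2_vert_def)
qed

lemma ell2_vert_diff:
  assumes "f \<in> ell2_vert T" "g \<in> ell2_vert T"
  shows "(\<lambda>x. f x - g x) \<in> ell2_vert T"
  using assms summable_on_power2_diff[of f "pverts T" g] by (simp add: ell2_vert_iff)

text \<open>
  Each vertex is the source of \<open>q + 1\<close> edges and the range of \<open>q + 1\<close> edges, so sums over edges of
  a function of one endpoint are multiples of sums over vertices.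
\<close>

lemma summable_on_parcs_endpoints:
  assumes "f \<in> ell2_vert T"
  shows "(\<lambda>e. (f (fst e))\<^sup>2) summable_on parcs T" "(\<lambda>e. (f (snd e))\<^sup>2) summable_on parcs T"
proof -
  have "(\<lambda>e. (f (fst e))\<^sup>2) summable_on (SIGMA x:pverts T. {y. (y, x) \<in> parcs T})"
  proof (rule summable_on_SigmaI)
    show "((\<lambda>y. (f (fst (x, y)))\<^sup>2) has_sum (real q + 1) * (f x)\<^sup>2) {y. (y, x) \<in> parcs T}"
      if "x \<in> pverts T" for x
      using finite_neighbours[OF that] card_neighbours[OF that] by (intro has_sum_finiteI) auto
    show "(\<lambda>x. (real q + 1) * (f x)\<^sup>2) summable_on pverts T"
      using assms by (intro summable_on_cmult_right) (simp add: ell2_vert_iff)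
  qed simp
  then show *: "(\<lambda>e. (f (fst e))\<^sup>2) summable_on parcs T"
    by (simp only: parcs_Sigma[symmetric])
  show "(\<lambda>e. (f (snd e))\<^sup>2) summable_on parcs T"
    using summable_on_reindex_bij_betw[OF bij_swap_parcs, of "\<lambda>e. (f (fst e))\<^sup>2"] * by simp
qed

lemma grad_in_ell2_alt:
  assumes "f \<in> ell2_vert T"
  shows "grad T f \<in> ell2_alt T"
proof -
  have "(\<lambda>e. (f (snd e) - f (fst e))\<^sup>2) summable_on parcs T"
    using assms by (intro summable_on_power2_diff summable_on_parcs_endpoints)
  then have "(\<lambda>e. (grad T f e)\<^sup>2) summable_on parcs T"
    by (rule summable_on_cong[THEN iffD1, rotated]) (simp add: grad_def)
  then show ?thesis
    by (auto simp: ell2_alt_def grad_def intro: arcs_symmetric)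
qed

lemma grad_diff: "grad T (\<lambda>x. f x - g x) = (\<lambda>e. grad T f e - grad T g e)"
  by (auto simp: grad_def fun_eq_iff)

text \<open>
  This is the adjointness of \<open>grad\<close> and \<open>grad_adj\<close> for a form \<open>u\<close> with \<open>grad_adj T u = 0\<close>: grouping
  the absolutely convergent sum of \<open>u e * f (fst e)\<close> by the vertex \<open>fst e\<close> produces the divergence
  of \<open>u\<close> at that vertex, and reversing the edges turns the sum with \<open>f (snd e)\<close> into the same sum.
\<close>

lemma edge_inner_grad:
  assumes u: "u \<in> ker_grad_adj T" and f: "f \<in> ell2_vert T"
  shows "edge_inner T u (grad T f) = 0"
proof -
  have u2: "u \<in> ell2_alt T"
    using u by (simp add: ker_grad_adj_def)
  have s1: "(\<lambda>e. u e * f (fst e)) summable_on parcs T"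
    and s2: "(\<lambda>e. u e * f (snd e)) summable_on parcs T"
    by (intro summable_on_mult_power2 summable_on_parcs_endpoints f ell2_altD(3)[OF u2])+
  have "(\<Sum>\<^sub>\<infinity>e\<in>parcs T. u e * f (fst e)) =
      (\<Sum>\<^sub>\<infinity>e\<in>(SIGMA x:pverts T. {y. (y, x) \<in> parcs T}). case e of (x, y) \<Rightarrow> u (x, y) * f x)"
    unfolding parcs_Sigma[symmetric] by (rule infsum_cong) (simp add: case_prod_beta)
  also have "\<dots> = (\<Sum>\<^sub>\<infinity>x\<in>pverts T. \<Sum>\<^sub>\<infinity>y\<in>{y. (y, x) \<in> parcs T}. u (x, y) * f x)"
    by (rule infsum_Sigma'_banach[symmetric]) (use s1 in \<open>simp add: case_prod_unfold parcs_Sigma[symmetric]\<close>)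
  also have "\<dots> = (\<Sum>\<^sub>\<infinity>x\<in>pverts T. 0)"
  proof (rule infsum_cong)
    fix x
    assume x: "x \<in> pverts T"
    have "(\<Sum>\<^sub>\<infinity>y\<in>{y. (y, x) \<in> parcs T}. u (x, y) * f x) = (\<Sum>y | (y, x) \<in> parcs T. - u (y, x) * f x)"
      using ell2_altD(2)[OF u2] finite_neighbours[OF x] by (auto intro!: sum.cong)
    also have "\<dots> = - (deg T x * grad_adj T u x) * f x"
      using x deg_eq[OF x] by (simp add: grad_adj_def sum_distrib_right[symmetric] sum_negf)
    also have "\<dots> = 0"
      using u x by (simp add: ker_grad_adj_def)
    finally show "(\<Sum>\<^sub>\<infinity>y\<in>{y. (y, x) \<in> parcs T}. u (x, y) * f x) = 0" .
  qed
  finally have tail0: "(\<Sum>\<^sub>\<infinity>e\<in>parcs T. u e * f (fst e)) = 0"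
    by simp
  have "(\<Sum>\<^sub>\<infinity>e\<in>parcs T. u e * f (snd e)) = (\<Sum>\<^sub>\<infinity>e\<in>parcs T. u (prod.swap e) * f (fst e))"
    using infsum_reindex_bij_betw[OF bij_swap_parcs, of "\<lambda>e. u e * f (snd e)"] by simp
  also have "\<dots> = (\<Sum>\<^sub>\<infinity>e\<in>parcs T. - (u e * f (fst e)))"
    by (rule infsum_cong) (simp add: ell2_altD(2)[OF u2])
  also have "\<dots> = 0"
    using tail0 by (simp add: infsum_uminus)
  finally have head0: "(\<Sum>\<^sub>\<infinity>e\<in>parcs T. u e * f (snd e)) = 0" .
  have "(\<Sum>\<^sub>\<infinity>e\<in>parcs T. u e * grad T f e) = (\<Sum>\<^sub>\<infinity>e\<in>parcs T. u e * f (snd e) - u e * f (fst e))"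
    by (rule infsum_cong) (simp add: grad_def right_diff_distrib)
  also have "\<dots> = 0"
    using s1 s2 head0 tail0 by (simp add: infsum_diff)
  finally show ?thesis
    by (simp add: edge_inner_def)
qed

text \<open>
  The definite description in \<open>orth_proj\<close> requires uniqueness: the difference of two candidates
  is a gradient orthogonal to all gradients, hence orthogonal to itself.
\<close>

lemma orth_proj_im_grad_eqI:
  assumes f: "f \<in> ell2_vert T" and h: "(\<lambda>e. u e - grad T f e) \<in> ker_grad_adj T"
  shows "orth_proj T (im_grad T) u = grad T f"
proof -
  let ?h = "\<lambda>e. u e - grad T f e"
  have h2: "?h \<in> ell2_alt T"
    using h by (simp add: ker_grad_adj_def)
  have orth: "edge_inner T ?h (grad T k) = 0" if "k \<in> ell2_vert T" for k
    by (rule edge_inner_grad[OF h that])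
  show ?thesis
    unfolding orth_proj_def
  proof (rule the_equality)
    show "grad T f \<in> im_grad T \<and> (\<forall>s\<in>im_grad T. edge_inner T ?h s = 0)"
      using f orth by (auto simp: im_grad_def)
  next
    fix p
    assume p: "p \<in> im_grad T \<and> (\<forall>s\<in>im_grad T. edge_inner T (\<lambda>e. u e - p e) s = 0)"
    then obtain k where k: "k \<in> ell2_vert T" "p = grad T k"
      by (auto simp: im_grad_def)
    define d where "d = grad T (\<lambda>x. k x - f x)"
    have kf: "(\<lambda>x. k x - f x) \<in> ell2_vert T"
      by (rule ell2_vert_diff[OF k(1) f])
    then have d2: "d \<in> ell2_alt T" and dim: "d \<in> im_grad T"
      by (auto simp: d_def im_grad_def grad_in_ell2_alt)
    have eq: "(\<lambda>e. u e - p e) = (\<lambda>e. ?h e - d e)"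
      by (simp add: d_def grad_diff k(2) fun_eq_iff)
    have "0 = edge_inner T (\<lambda>e. ?h e - d e) d"
      using p dim eq by metis
    also have "\<dots> = edge_inner T ?h d - edge_inner T d d"
      by (rule edge_inner_diff_left[OF h2 d2 d2])
    also have "edge_inner T ?h d = 0"
      unfolding d_def by (rule orth[OF kf])
    finally have "d = (\<lambda>e. 0)"
      using edge_inner_self_eq_0[OF d2] by simp
    then show "p = grad T f"
      by (simp add: d_def grad_diff k(2) fun_eq_iff)
  qed
qed

section \<open>The harmonic representative of a geodesic\<close>

text \<open>
  The linear part alone has Laplacian of a different value at distance 0 than elsewhere. The
  exponential part is harmonic away from distance 0, and its coefficient is chosen such that the
  two defects at distance 0 cancel.
\<close>

definition potential :: "nat \<Rightarrow> real" where
  "potential n = real n / 2 + real q / ((real q)\<^sup>2 - 1) * (1 / real q) ^ n"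

text \<open>
  The square-summable function whose Laplacian, the sum of the differences to the neighbours, is
  the indicator of \<open>z\<close>.
\<close>

definition green :: "'v \<Rightarrow> 'v \<Rightarrow> real" where
  "green z v = (if v \<in> pverts T then real q / ((real q)\<^sup>2 - 1) * (1 / real q) ^ gdist T z v else 0)"

text \<open>
  The image of \<open>chi T x y\<close> under the projection onto \<open>ker_grad_adj T\<close>, in closed form.
\<close>

definition harmonic_form :: "'v \<Rightarrow> 'v \<Rightarrow> ('v \<times> 'v \<Rightarrow> real)" where
  "harmonic_form x y = grad T (\<lambda>v. potential (gdist T x v) - potential (gdist T y v))"

lemma q_square_gt_1: "(real q)\<^sup>2 - 1 > 0"
proof -
  have "1 < real q"
    using q_ge_2 by simp
  then have "1 < (real q)\<^sup>2"
    by (simp add: one_less_power)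
  then show ?thesis by simp
qed

lemma green_in_ell2_vert:
  assumes "z \<in> pverts T"
  shows "green z \<in> ell2_vert T"
proof -
  have "(\<lambda>v. (real q / ((real q)\<^sup>2 - 1))\<^sup>2 * ((1 / real q) ^ gdist T z v)\<^sup>2) summable_on pverts T"
    by (intro summable_on_cmult_right summable_on_exp_gdist assms)
  then have "(\<lambda>v. (green z v)\<^sup>2) summable_on pverts T"
    by (rule summable_on_cong[THEN iffD1, rotated]) (simp only: green_def if_True power_mult_distrib)
  then show ?thesis
    by (simp add: ell2_vert_iff green_def)
qed

lemma sum_neighbours_gdist:
  assumes "z \<in> pverts T" "v \<in> pverts T"
  shows "(\<Sum>y | (y, v) \<in> parcs T. h (gdist T z y)) =
    (if v = z then (real q + 1) * h 1 else h (gdist T z v - 1) + real q * h (gdist T z v + 1))"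
proof (cases "v = z")
  case True
  have "gdist T z y = 1" if "(y, v) \<in> parcs T" for y
    using gdist_neighbour[OF assms(1) arcs_symmetric[OF that]] gdist_self[OF assms(1)] True by simp
  then have "(\<Sum>y | (y, v) \<in> parcs T. h (gdist T z y)) = (\<Sum>y | (y, v) \<in> parcs T. h 1)"
    by (intro sum.cong) auto
  then show ?thesis
    using True card_neighbours[OF assms(2)] by simp
next
  case False
  then obtain w where w: "(w, v) \<in> parcs T" "gdist T z v = gdist T z w + 1"
    and uniq: "\<And>y. (y, v) \<in> parcs T \<Longrightarrow> gdist T z v = gdist T z y + 1 \<Longrightarrow> y = w"
    using closer_neighbour[OF assms] by blast
  let ?N = "{y. (y, v) \<in> parcs T}"
  have "(\<Sum>y\<in>?N. h (gdist T z y)) = h (gdist T z w) + (\<Sum>y\<in>?N - {w}. h (gdist T z y))"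
    by (rule sum.remove) (use w finite_neighbours[OF assms(2)] in auto)
  also have "(\<Sum>y\<in>?N - {w}. h (gdist T z y)) = (\<Sum>y\<in>?N - {w}. h (gdist T z v + 1))"
  proof (rule sum.cong)
    fix y
    assume "y \<in> ?N - {w}"
    then show "h (gdist T z y) = h (gdist T z v + 1)"
      using gdist_neighbour[OF assms(1), of y v] uniq[of y] by auto
  qed simp
  also have "\<dots> = real q * h (gdist T z v + 1)"
    using w card_neighbours[OF assms(2)] finite_neighbours[OF assms(2)] by simp
  finally show ?thesis
    using w False by simp
qed

text \<open>
  The value does not depend on \<open>v\<close> or \<open>z\<close>, and it holds at \<open>v = z\<close> as well. Hence the difference
  of the potentials with poles \<open>x\<close> and \<open>y\<close> is harmonic on the whole tree.
\<close>

lemma laplacian_potential: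
  assumes "z \<in> pverts T" "v \<in> pverts T"
  shows "(\<Sum>y | (y, v) \<in> parcs T. potential (gdist T z v) - potential (gdist T z y)) = (1 - real q) / 2"
proof -
  have nz: "real q \<noteq> 0" "(real q)\<^sup>2 - 1 \<noteq> 0"
    using q_ge_2 less_imp_neq[OF q_square_gt_1] by simp_all
  define c where "c = real q / ((real q)\<^sup>2 - 1)"
  have c: "c * ((real q)\<^sup>2 - 1) = real q"
    using nz by (simp add: c_def)
  have pot: "potential n = real n / 2 + c * (1 / real q) ^ n" for n
    by (simp add: potential_def c_def)
  have "(\<Sum>y | (y, v) \<in> parcs T. potential (gdist T z v) - potential (gdist T z y)) =
      (real q + 1) * potential (gdist T z v) - (\<Sum>y | (y, v) \<in> parcs T. potential (gdist T z y))"
    using card_neighbours[OF assms(2)] by (simp add: sum_subtractf)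
  also have "\<dots> = (1 - real q) / 2"
  proof (cases "v = z")
    case True
    have "(real q + 1) * (potential 0 - potential 1) = (1 - real q) / 2"
    proof -
      have "real q * ((real q + 1) * (potential 0 - potential 1)) =
          c * ((real q)\<^sup>2 - 1) - real q * (real q + 1) / 2"
        using nz by (simp add: pot field_simps power2_eq_square)
      also have "\<dots> = real q * ((1 - real q) / 2)"
        unfolding c by (simp add: field_simps)
      finally show ?thesis
        by (rule mult_left_cancel[OF nz(1), THEN iffD1])
    qed
    then show ?thesis
      unfolding sum_neighbours_gdist[OF assms] using True gdist_self[OF assms(1)]
      by (simp add: right_diff_distrib)
  next
    case False
    then have "gdist T z v \<noteq> 0"
      using gdist_eq_0_iff[OF assms] by simp
    then obtain m where m: "gdist T z v = Suc m"
      by (cases "gdist T z v") auto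
    have "(real q + 1) * potential (Suc m) - (potential m + real q * potential (Suc (Suc m))) =
        (1 - real q) / 2"
      using nz by (simp add: pot field_simps power2_eq_square)
    then show ?thesis
      unfolding sum_neighbours_gdist[OF assms] using False m by simp
  qed
  finally show ?thesis .
qed

lemma grad_adj_harmonic_form:
  assumes "x \<in> pverts T" "y \<in> pverts T" "v \<in> pverts T"
  shows "grad_adj T (harmonic_form x y) v = 0"
proof -
  have "(\<Sum>w | (w, v) \<in> parcs T. harmonic_form x y (w, v)) =
      (\<Sum>w | (w, v) \<in> parcs T. (potential (gdist T x v) - potential (gdist T x w)) -
        (potential (gdist T y v) - potential (gdist T y w)))"
    by (rule sum.cong) (auto simp: harmonic_form_def grad_def)
  also have "\<dots> = 0"
    unfolding sum_subtractf[of "\<lambda>w. potential (gdist T x v) - potential (gdist T x w)"]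
    by (simp only: laplacian_potential assms)
  finally show ?thesis
    by (simp add: grad_adj_def)
qed

lemma harmonic_form_eq_chi_minus_grad:
  assumes "x \<in> pverts T" "y \<in> pverts T"
  shows "harmonic_form x y = (\<lambda>e. chi T x y e - grad T (\<lambda>v. green y v - green x v) e)"
proof
  fix e
  show "harmonic_form x y e = chi T x y e - grad T (\<lambda>v. green y v - green x v) e"
  proof (cases "e \<in> parcs T")
    case True
    then have "fst e \<in> pverts T" "snd e \<in> pverts T"
      by (auto intro: arc_fst_in_verts arc_snd_in_verts)
    then show ?thesis
      using True unfolding chi_eq_grad_gdist[OF assms] harmonic_form_def
      by (simp add: grad_def green_def potential_def field_simps)
  next
    case False
    then show ?thesis
      unfolding chi_eq_grad_gdist[OF assms] harmonic_form_def by (simp add: grad_def)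
  qed
qed

lemma geodesic_swap_disjoint:
  assumes "x \<in> pverts T" "y \<in> pverts T" "e \<in> set (geodesic T x y)"
  shows "prod.swap e \<notin> set (geodesic T x y)"
proof -
  obtain a b where e: "e = (a, b)" by fastforce
  have ab: "(a, b) \<in> parcs T"
    using geodesic_subset_arcs[OF assms(1,2)] assms(3) e by blast
  show ?thesis
    using geodesic_edge_iff[OF assms(1,2) ab] geodesic_edge_iff[OF assms(1,2) arcs_symmetric[OF ab]]
      assms(3) e by simp
qed

lemma chi_support:
  "{e. chi T x y e \<noteq> 0} \<subseteq> set (geodesic T x y) \<union> prod.swap ` set (geodesic T x y)"
proof
  fix e
  assume "e \<in> {e. chi T x y e \<noteq> 0}"
  then have "e \<in> set (geodesic T x y) \<or> prod.swap e \<in> set (geodesic T x y)"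
    by (auto simp: chi_def split: if_splits)
  then show "e \<in> set (geodesic T x y) \<union> prod.swap ` set (geodesic T x y)"
    by (metis UnI1 UnI2 image_eqI swap_swap)
qed

lemma chi_in_ell2_alt:
  assumes "x \<in> pverts T" "y \<in> pverts T"
  shows "chi T x y \<in> ell2_alt T"
proof -
  have "finite {e. chi T x y e \<noteq> 0}"
    by (rule finite_subset[OF chi_support]) simp
  then have "finite {e \<in> parcs T. (chi T x y e)\<^sup>2 \<noteq> 0}"
    by (rule rev_finite_subset) auto
  then have "(\<lambda>e. (chi T x y e)\<^sup>2) summable_on parcs T"
    by (rule finite_nonzero_values_imp_summable_on)
  moreover have "chi T x y (prod.swap e) = - chi T x y e" if "e \<in> parcs T" for e
    using that swap_in_parcs_iff[of e] by (simp add: chi_eq_grad_gdist[OF assms] grad_def)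
  moreover have "chi T x y e = 0" if "e \<notin> parcs T" for e
    using that by (simp add: chi_eq_grad_gdist[OF assms] grad_def)
  ultimately show ?thesis
    unfolding ell2_alt_def by blast
qed

text \<open>
  The factor \<open>1 / 2\<close> in \<open>edge_inner\<close> compensates that every edge of the geodesic contributes in
  both orientations, with equal products because both forms are alternating.
\<close>

lemma edge_inner_chi:
  assumes "x \<in> pverts T" "y \<in> pverts T" "u \<in> ell2_alt T"
  shows "edge_inner T u (chi T x y) = sum_list (map u (geodesic T x y))"
proof -
  let ?S = "set (geodesic T x y)"
  have sub: "?S \<subseteq> parcs T"
    by (rule geodesic_subset_arcs[OF assms(1,2)])
  have sub': "prod.swap ` ?S \<subseteq> parcs T"
    using sub swap_in_parcs_iff by blast
  have disj: "?S \<inter> prod.swap ` ?S = {}"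
    using geodesic_swap_disjoint[OF assms(1,2)] by force
  have "(\<Sum>\<^sub>\<infinity>e\<in>parcs T. u e * chi T x y e) = (\<Sum>\<^sub>\<infinity>e\<in>?S \<union> prod.swap ` ?S. u e * chi T x y e)"
  proof (rule infsum_cong_neutral)
    show "u e * chi T x y e = 0" if "e \<in> parcs T - (?S \<union> prod.swap ` ?S)" for e
      using chi_support[of x y] that by auto
  qed (use sub sub' in auto)
  also have "\<dots> = (\<Sum>e\<in>?S \<union> prod.swap ` ?S. u e * chi T x y e)"
    by simp
  also have "\<dots> = (\<Sum>e\<in>?S. u e * chi T x y e) + (\<Sum>e\<in>prod.swap ` ?S. u e * chi T x y e)"
    by (rule sum.union_disjoint) (use disj in auto)
  also have "(\<Sum>e\<in>?S. u e * chi T x y e) = (\<Sum>e\<in>?S. u e)"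
    by (rule sum.cong) (simp_all add: chi_def)
  also have "(\<Sum>e\<in>prod.swap ` ?S. u e * chi T x y e) =
      (\<Sum>e\<in>?S. u (prod.swap e) * chi T x y (prod.swap e))"
    by (rule sum.reindex[THEN trans]) (simp_all add: o_def)
  also have "\<dots> = (\<Sum>e\<in>?S. u e)"
  proof (rule sum.cong)
    fix e
    assume e: "e \<in> ?S"
    then have "u (prod.swap e) = - u e"
      using ell2_altD(2)[OF assms(3)] sub by blast
    moreover have "chi T x y (prod.swap e) = - 1"
      using e geodesic_swap_disjoint[OF assms(1,2) e] by (simp add: chi_def)
    ultimately show "u (prod.swap e) * chi T x y (prod.swap e) = u e"
      by simp
  qed simp
  also have "(\<Sum>e\<in>?S. u e) + (\<Sum>e\<in>?S. u e) = 2 * sum_list (map u (geodesic T x y))"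
    using geodesic_distinct[OF assms(1,2)] by (simp add: sum_list_distinct_conv_sum_set)
  finally show ?thesis
    by (simp add: edge_inner_def)
qed

lemma green_diff_in_ell2_vert:
  assumes "x \<in> pverts T" "y \<in> pverts T"
  shows "(\<lambda>v. green y v - green x v) \<in> ell2_vert T"
  by (rule ell2_vert_diff[OF green_in_ell2_vert[OF assms(2)] green_in_ell2_vert[OF assms(1)]])

lemma harmonic_form_in_ker:
  assumes "x \<in> pverts T" "y \<in> pverts T"
  shows "harmonic_form x y \<in> ker_grad_adj T"
proof -
  have "harmonic_form x y \<in> ell2_alt T"
    unfolding harmonic_form_eq_chi_minus_grad[OF assms]
    by (rule ell2_alt_diff[OF chi_in_ell2_alt[OF assms] grad_in_ell2_alt[OF green_diff_in_ell2_vert[OF assms]]])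
  then show ?thesis
    using grad_adj_harmonic_form[OF assms] by (simp add: ker_grad_adj_def)
qed

text \<open>
  The decomposition of \<open>chi\<close> into \<open>harmonic_form\<close> and the gradient of a difference of Green
  functions is orthogonal, so the second summand is the projection onto \<open>im_grad T\<close>.
\<close>

lemma harmonic_cocycle_eq:
  assumes "x0 \<in> pverts T" "g x0 \<in> pverts T"
  shows "harmonic_cocycle T x0 g = harmonic_form x0 (g x0)"
proof -
  have "orth_proj T (im_grad T) (chi T x0 (g x0)) = grad T (\<lambda>v. green (g x0) v - green x0 v)"
    by (rule orth_proj_im_grad_eqI[OF green_diff_in_ell2_vert[OF assms]])
      (use harmonic_form_in_ker[OF assms] in \<open>simp only: harmonic_form_eq_chi_minus_grad[OF assms]\<close>)
  then show ?thesis
    by (simp only: harmonic_cocycle_def harmonic_form_eq_chi_minus_grad[OF assms])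
qed

text \<open>
  As the form is orthogonal to gradients, its square norm is its inner product with \<open>chi T x y\<close>,
  which is the sum of the form along the geodesic. The form being a gradient, this sum telescopes
  to twice the increase of the potential over the distance between \<open>x\<close> and \<open>y\<close>.
\<close>

lemma edge_norm_harmonic_form:
  assumes "x \<in> pverts T" "y \<in> pverts T"
  shows "(edge_norm T (harmonic_form x y))\<^sup>2 = real (gdist T x y) +
    2 * real q / ((real q)\<^sup>2 - 1) * (real q powi (- int (gdist T x y)) - 1)"
proof -
  let ?h = "harmonic_form x y"
  let ?g = "\<lambda>v. green y v - green x v"
  note ker = harmonic_form_in_ker[OF assms]
  have ell2: "?h \<in> ell2_alt T"
    using ker by (simp add: ker_grad_adj_def)
  note gr = green_diff_in_ell2_vert[OF assms]
  have "(edge_norm T ?h)\<^sup>2 = edge_inner T ?h ?h"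
    by (simp add: edge_norm_def edge_inner_self_nonneg)
  also have "\<dots> = edge_inner T (\<lambda>e. chi T x y e - grad T ?g e) ?h"
    by (simp only: harmonic_form_eq_chi_minus_grad[OF assms])
  also have "\<dots> = edge_inner T (chi T x y) ?h - edge_inner T (grad T ?g) ?h"
    by (rule edge_inner_diff_left[OF chi_in_ell2_alt[OF assms] grad_in_ell2_alt[OF gr] ell2])
  also have "edge_inner T (grad T ?g) ?h = 0"
    using edge_inner_grad[OF ker gr] by (simp only: edge_inner_commute)
  also have "edge_inner T (chi T x y) ?h = sum_list (map ?h (geodesic T x y))"
    using edge_inner_chi[OF assms ell2] by (simp only: edge_inner_commute)
  also have "\<dots> = (potential (gdist T x y) - potential (gdist T y y)) -
      (potential (gdist T x x) - potential (gdist T y x))"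
    unfolding harmonic_form_def by (rule sum_grad_walk[OF geodesic_walk(1)[OF assms]])
  also have "\<dots> = 2 * (potential (gdist T x y) - potential 0)"
    by (simp only: gdist_self assms gdist_sym[OF assms]) simp
  finally have "(edge_norm T ?h)\<^sup>2 = 2 * (potential (gdist T x y) - potential 0)"
    by simp
  moreover have "real q powi (- int n) = (1 / real q) ^ n" for n
    by (simp add: power_int_minus power_one_over inverse_eq_divide)
  ultimately show ?thesis
    by (simp add: potential_def algebra_simps diff_divide_distrib)
qed

end

section \<open>Automorphisms\<close>

context bidirected_tree
begin

text \<open>
  Applied to an automorphism and to its inverse, this gives invariance of the distance.
\<close>

lemma gdist_endomorphism_le:
  assumes "\<And>x. x \<in> pverts T \<Longrightarrow> h x \<in> pverts T"
    and "\<And>x y. (x, y) \<in> parcs T \<Longrightarrow> (h x, h y) \<in> parcs T"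
    and "x \<in> pverts T" "y \<in> pverts T"
  shows "gdist T (h x) (h y) \<le> gdist T x y"
proof -
  have "awalk (h x) (map (map_prod h h) p) (h y)" if "awalk x p y" for p
    using that
  proof (induction p arbitrary: x)
    case Nil
    then show ?case
      using assms(1) by (auto simp: awalk_Nil_iff)
  next
    case (Cons e p)
    then show ?case
      using assms(2)[of "fst e" "snd e"] by (cases e) (simp add: awalk_Cons_iff)
  qed
  from gdist_le_length[OF this[OF geodesic_walk(1)[OF assms(3,4)]]] show ?thesis
    using geodesic_walk(3)[OF assms(3,4)] by simp
qed

lemma aut_groupD:
  assumes "g \<in> carrier (aut_group T)"
  shows "bij_betw g (pverts T) (pverts T)" "g \<in> extensional (pverts T)"
    "\<And>x y. \<lbrakk>x \<in> pverts T; y \<in> pverts T\<rbrakk> \<Longrightarrow> (g x, g y) \<in> parcs T \<longleftrightarrow> (x, y) \<in> parcs T"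
    "\<And>x. x \<in> pverts T \<Longrightarrow> g x \<in> pverts T"
  using assms by (auto simp: aut_group_def Bij_def dest: bij_betw_apply)

lemma aut_group_mult:
  assumes "g \<in> carrier (aut_group T)" "h \<in> carrier (aut_group T)" "x \<in> pverts T"
  shows "(g \<otimes>\<^bsub>aut_group T\<^esub> h) x = g (h x)"
  using assms by (simp add: aut_group_def BijGroup_def compose_def)

context
  fixes g
  assumes g: "g \<in> carrier (aut_group T)"
begin

lemma inv_aut:
  assumes "x \<in> pverts T"
  shows "inv_into (pverts T) g x \<in> pverts T" "g (inv_into (pverts T) g x) = x"
    "inv_into (pverts T) g (g x) = x"
  using aut_groupD(1)[OF g] assms
  by (auto simp: bij_betw_def inv_into_into f_inv_into_f)

lemma inv_aut_arc_iff:
  assumes "x \<in> pverts T" "y \<in> pverts T"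
  shows "(inv_into (pverts T) g x, inv_into (pverts T) g y) \<in> parcs T \<longleftrightarrow> (x, y) \<in> parcs T"
  using aut_groupD(3)[OF g inv_aut(1)[OF assms(1)] inv_aut(1)[OF assms(2)]] inv_aut(2) assms by simp

lemma inv_aut_arc:
  assumes "(x, y) \<in> parcs T"
  shows "(inv_into (pverts T) g x, inv_into (pverts T) g y) \<in> parcs T"
  using inv_aut_arc_iff[OF in_arcsD1[OF assms] in_arcsD2[OF assms]] assms by simp

lemma gdist_aut:
  assumes "x \<in> pverts T" "y \<in> pverts T"
  shows "gdist T (g x) (g y) = gdist T x y"
proof (rule antisym)
  have arc: "(g x, g y) \<in> parcs T" if "(x, y) \<in> parcs T" for x y
    using aut_groupD(3)[OF g in_arcsD1[OF that] in_arcsD2[OF that]] that by simp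
  show "gdist T (g x) (g y) \<le> gdist T x y"
    by (rule gdist_endomorphism_le[OF aut_groupD(4)[OF g] arc assms])
  have "gdist T (inv_into (pverts T) g (g x)) (inv_into (pverts T) g (g y)) \<le> gdist T (g x) (g y)"
    by (rule gdist_endomorphism_le[OF inv_aut(1) inv_aut_arc])
      (use aut_groupD(4)[OF g] assms in auto)
  then show "gdist T x y \<le> gdist T (g x) (g y)"
    by (simp only: inv_aut(3) assms)
qed

lemma gdist_inv_aut:
  assumes "x \<in> pverts T" "y \<in> pverts T"
  shows "gdist T x (inv_into (pverts T) g y) = gdist T (g x) y"
  using gdist_aut[OF assms(1) inv_aut(1)[OF assms(2)]] inv_aut(2)[OF assms(2)] by simp

end

end

context homogeneous_tree
begin

lemma edge_rep_harmonic_form: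
  assumes "g \<in> carrier (aut_group T)" "x \<in> pverts T" "y \<in> pverts T"
  shows "edge_rep T g (harmonic_form x y) = harmonic_form (g x) (g y)"
proof
  fix e
  show "edge_rep T g (harmonic_form x y) e = harmonic_form (g x) (g y) e"
  proof (cases "e \<in> parcs T")
    case True
    then have "fst e \<in> pverts T" "snd e \<in> pverts T"
      by (auto intro: arc_fst_in_verts arc_snd_in_verts)
    then show ?thesis
      using True inv_aut_arc[OF assms(1), of "fst e" "snd e"]
      by (simp add: edge_rep_def harmonic_form_def grad_def gdist_inv_aut[OF assms(1)] assms)
  qed (simp add: edge_rep_def harmonic_form_def grad_def)
qed

lemma harmonic_form_add: "harmonic_form x z = (\<lambda>e. harmonic_form y z e + harmonic_form x y e)"
  by (simp add: harmonic_form_def grad_def fun_eq_iff)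

lemma edge_rep_ker_grad_adj:
  assumes g: "g \<in> carrier (aut_group T)" and u: "u \<in> ker_grad_adj T"
  shows "edge_rep T g u \<in> ker_grad_adj T"
proof -
  let ?i = "inv_into (pverts T) g"
  have u2: "u \<in> ell2_alt T"
    using u by (simp add: ker_grad_adj_def)
  have bij: "bij_betw (map_prod ?i ?i) (parcs T) (parcs T)"
  proof (rule bij_betw_byWitness[of _ "map_prod g g"])
    show "\<forall>e\<in>parcs T. map_prod g g (map_prod ?i ?i e) = e"
      using inv_aut(2)[OF g] in_arcsD1 in_arcsD2 by auto
    show "\<forall>e\<in>parcs T. map_prod ?i ?i (map_prod g g e) = e"
      using inv_aut(3)[OF g] in_arcsD1 in_arcsD2 by auto
    show "map_prod ?i ?i ` parcs T \<subseteq> parcs T"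
      using inv_aut_arc[OF g] by auto
    show "map_prod g g ` parcs T \<subseteq> parcs T"
      using aut_groupD(3)[OF g] in_arcsD1 in_arcsD2 by auto
  qed
  have "(\<lambda>e. (u (map_prod ?i ?i e))\<^sup>2) summable_on parcs T"
    using ell2_altD(3)[OF u2] summable_on_reindex_bij_betw[OF bij, of "\<lambda>e. (u e)\<^sup>2"] by simp
  then have sq: "(\<lambda>e. (edge_rep T g u e)\<^sup>2) summable_on parcs T"
    by (rule summable_on_cong[THEN iffD1, rotated]) (auto simp: edge_rep_def)
  have alt: "edge_rep T g u (prod.swap e) = - edge_rep T g u e" if "e \<in> parcs T" for e
  proof -
    obtain a b where e: "e = (a, b)" by fastforce
    show ?thesis
      using that arcs_symmetric[of a b] inv_aut_arc[OF g, of a b] ell2_altD(2)[OF u2, of "(?i a, ?i b)"]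
      unfolding e by (simp add: edge_rep_def)
  qed
  have "edge_rep T g u \<in> ell2_alt T"
    using sq alt by (simp add: ell2_alt_def edge_rep_def)
  moreover have "grad_adj T (edge_rep T g u) x = 0" if x: "x \<in> pverts T" for x
  proof -
    have bijN: "bij_betw ?i {y. (y, x) \<in> parcs T} {y. (y, ?i x) \<in> parcs T}"
    proof (rule bij_betw_byWitness[of _ g])
      show "\<forall>y\<in>{y. (y, x) \<in> parcs T}. g (?i y) = y"
        using inv_aut(2)[OF g] in_arcsD1 by auto
      show "\<forall>y\<in>{y. (y, ?i x) \<in> parcs T}. ?i (g y) = y"
        using inv_aut(3)[OF g] in_arcsD1 by auto
      show "?i ` {y. (y, x) \<in> parcs T} \<subseteq> {y. (y, ?i x) \<in> parcs T}"
        using inv_aut_arc[OF g] by auto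
      show "g ` {y. (y, ?i x) \<in> parcs T} \<subseteq> {y. (y, x) \<in> parcs T}"
      proof clarify
        fix y
        assume y: "(y, ?i x) \<in> parcs T"
        show "(g y, x) \<in> parcs T"
          using aut_groupD(3)[OF g in_arcsD1[OF y] inv_aut(1)[OF g x]] y inv_aut(2)[OF g x] by simp
      qed
    qed
    have "(\<Sum>y | (y, x) \<in> parcs T. edge_rep T g u (y, x)) = (\<Sum>y | (y, x) \<in> parcs T. u (?i y, ?i x))"
      by (rule sum.cong) (simp_all add: edge_rep_def)
    also have "\<dots> = (\<Sum>y | (y, ?i x) \<in> parcs T. u (y, ?i x))"
      by (rule sum.reindex_bij_betw[OF bijN])
    also have "\<dots> = deg T (?i x) * grad_adj T u (?i x)"
      using deg_eq[OF inv_aut(1)[OF g x]] by (simp add: grad_adj_def)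
    also have "\<dots> = 0"
      using u inv_aut(1)[OF g x] by (simp add: ker_grad_adj_def)
    finally show ?thesis
      by (simp add: grad_adj_def)
  qed
  ultimately show ?thesis
    by (simp add: ker_grad_adj_def)
qed

lemma is_cocycle_harmonic_cocycle:
  assumes G: "subgroup G (aut_group T)" and x0: "x0 \<in> pverts T"
  shows "is_cocycle T G (ker_grad_adj T) (harmonic_cocycle T x0)"
proof -
  have aut: "g \<in> carrier (aut_group T)" if "g \<in> G" for g
    using subgroup.mem_carrier[OF G that] .
  have b: "harmonic_cocycle T x0 g = harmonic_form x0 (g x0)" if "g \<in> G" for g
    by (rule harmonic_cocycle_eq[of x0 g, OF x0 aut_groupD(4)[OF aut[OF that] x0]])
  have "harmonic_cocycle T x0 (g \<otimes>\<^bsub>aut_group T\<^esub> h) =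
      (\<lambda>e. edge_rep T g (harmonic_cocycle T x0 h) e + harmonic_cocycle T x0 g e)"
    if g: "g \<in> G" and h: "h \<in> G" for g h
  proof -
    have hx: "h x0 \<in> pverts T"
      by (rule aut_groupD(4)[OF aut[OF h] x0])
    show ?thesis
      unfolding b[OF subgroup.m_closed[OF G g h]] b[OF g] b[OF h] aut_group_mult[OF aut[OF g] aut[OF h] x0]
        edge_rep_harmonic_form[OF aut[OF g] x0 hx]
      by (rule harmonic_form_add)
  qed
  moreover have "harmonic_cocycle T x0 g \<in> ker_grad_adj T" if "g \<in> G" for g
    unfolding b[OF that] by (rule harmonic_form_in_ker[OF x0 aut_groupD(4)[OF aut[OF that] x0]])
  ultimately show ?thesis
    unfolding is_cocycle_def using edge_rep_ker_grad_adj aut by blast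
qed

section \<open>Properness\<close>

lemma finite_ball: "x \<in> pverts T \<Longrightarrow> finite {v \<in> pverts T. gdist T x v \<le> n}"
proof -
  assume x: "x \<in> pverts T"
  have "{v \<in> pverts T. gdist T x v \<le> n} = (\<Union>k\<le>n. {v \<in> pverts T. gdist T x v = k})"
    by auto
  then show ?thesis
    using sphere_finite_card_le[OF x] by simp
qed

definition function_top :: "('v \<Rightarrow> 'v) topology" where
  "function_top = product_topology (\<lambda>_. discrete_topology (pverts T)) (pverts T)"

lemma topspace_function_top: "topspace function_top = (pverts T \<rightarrow>\<^sub>E pverts T)"
  by (simp add: function_top_def)

text \<open>
  The pair of values at \<open>v\<close> and \<open>w\<close> is a continuous function into a discrete space, so every
  condition on it is closed.
\<close>

lemma closedin_two_coordinates:
  assumes "v \<in> pverts T" "w \<in> pverts T"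
  shows "closedin function_top {f \<in> topspace function_top. Q (f v) (f w)}"
proof -
  let ?D = "discrete_topology (pverts T)"
  have "continuous_map function_top (prod_topology ?D ?D) (\<lambda>f. (f v, f w))"
    unfolding function_top_def
    by (intro continuous_map_pairedI continuous_map_product_projection assms)
  then have cont: "continuous_map function_top (discrete_topology (pverts T \<times> pverts T)) (\<lambda>f. (f v, f w))"
    by (simp only: prod_topology_discrete_topology)
  have "closedin (discrete_topology (pverts T \<times> pverts T)) {p \<in> pverts T \<times> pverts T. Q (fst p) (snd p)}"
    by (simp add: closedin_discrete_topology)
  from closedin_continuous_map_preimage[OF cont this]
  have "closedin function_top {f \<in> topspace function_top.
      (f v, f w) \<in> {p \<in> pverts T \<times> pverts T. Q (fst p) (snd p)}}" .
  moreover have "{f \<in> topspace function_top. (f v, f w) \<in> {p \<in> pverts T \<times> pverts T. Q (fst p) (snd p)}} =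
      {f \<in> topspace function_top. Q (f v) (f w)}"
    using assms by (auto simp: topspace_function_top)
  ultimately show ?thesis by simp
qed

definition bounded_auts :: "'v \<Rightarrow> nat \<Rightarrow> ('v \<Rightarrow> 'v) set" where
  "bounded_auts x0 n = {g \<in> carrier (aut_group T). gdist T x0 (g x0) \<le> n}"

text \<open>
  Of the properties that define an automorphism, only surjectivity is not a conjunction of
  conditions on finitely many values: for each \<open>w\<close> it is an infinite disjunction. If \<open>x0\<close> is moved by
  at most \<open>n\<close>, the preimage of \<open>w\<close> has distance at most \<open>n + gdist T x0 w\<close> from \<open>x0\<close>, which makes
  that disjunction finite and the condition closed.
\<close>

lemma bounded_auts_pointwise:
  assumes x0: "x0 \<in> pverts T"
  defines "P \<equiv> topspace function_top"
  shows "bounded_auts x0 n =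
    {f \<in> P. gdist T x0 (f x0) \<le> n} \<inter>
    (\<Inter>x\<in>pverts T. \<Inter>y\<in>pverts T. {f \<in> P. (f x = f y \<longrightarrow> x = y) \<and> ((f x, f y) \<in> parcs T \<longleftrightarrow> (x, y) \<in> parcs T)}) \<inter>
    (\<Inter>w\<in>pverts T. \<Union>v\<in>{v \<in> pverts T. gdist T x0 v \<le> n + gdist T x0 w}. {f \<in> P. f v = w})"
    (is "_ = ?A \<inter> ?B \<inter> ?C")
proof (intro equalityI subsetI)
  fix g
  assume "g \<in> bounded_auts x0 n"
  then have g: "g \<in> carrier (aut_group T)" and n: "gdist T x0 (g x0) \<le> n"
    by (auto simp: bounded_auts_def)
  have gP: "g \<in> P"
    using aut_groupD(2,4)[OF g] by (simp add: P_def topspace_function_top PiE_iff)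
  have "g \<in> ?B"
    using gP aut_groupD(1,3)[OF g] by (auto simp: bij_betw_def dest: inj_onD)
  moreover have "g \<in> ?C"
  proof (rule INT_I)
    fix w
    assume w: "w \<in> pverts T"
    let ?v = "inv_into (pverts T) g w"
    note v = inv_aut(1,2)[OF g w]
    have "gdist T x0 ?v = gdist T (g x0) w"
      by (rule gdist_inv_aut[OF g x0 w])
    also have "\<dots> \<le> gdist T (g x0) x0 + gdist T x0 w"
      by (rule gdist_triangle[OF aut_groupD(4)[OF g x0] x0 w])
    also have "\<dots> \<le> n + gdist T x0 w"
      using n gdist_sym[OF x0 aut_groupD(4)[OF g x0]] by simp
    finally show "g \<in> (\<Union>v\<in>{v \<in> pverts T. gdist T x0 v \<le> n + gdist T x0 w}. {f \<in> P. f v = w})"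
      using v gP by blast
  qed
  ultimately show "g \<in> ?A \<inter> ?B \<inter> ?C"
    using gP n by blast
next
  fix g
  assume g: "g \<in> ?A \<inter> ?B \<inter> ?C"
  then have P: "g \<in> pverts T \<rightarrow>\<^sub>E pverts T" and n: "gdist T x0 (g x0) \<le> n"
    by (auto simp: P_def topspace_function_top)
  have pres: "(g x = g y \<longrightarrow> x = y) \<and> ((g x, g y) \<in> parcs T \<longleftrightarrow> (x, y) \<in> parcs T)"
    if "x \<in> pverts T" "y \<in> pverts T" for x y
    using g that by blast
  have surj: "\<exists>v\<in>pverts T. g v = w" if "w \<in> pverts T" for w
    using g that by blast
  have "inj_on g (pverts T)"
    using pres by (auto intro!: inj_onI)
  moreover have "g ` pverts T = pverts T"
    using P surj by (auto simp: PiE_iff image_iff)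
  ultimately have "g \<in> Bij (pverts T)"
    using P by (simp add: Bij_def bij_betw_def PiE_iff)
  then show "g \<in> bounded_auts x0 n"
    using pres n by (simp add: bounded_auts_def aut_group_def)
qed

lemma closedin_bounded_auts:
  assumes x0: "x0 \<in> pverts T"
  shows "closedin function_top (bounded_auts x0 n)"
proof -
  have ne: "pverts T \<noteq> {}"
    using x0 by blast
  show ?thesis
    unfolding bounded_auts_pointwise[OF x0]
  proof (intro closedin_Int)
    show "closedin function_top {f \<in> topspace function_top. gdist T x0 (f x0) \<le> n}"
      by (rule closedin_two_coordinates[OF x0 x0, of "\<lambda>a b. gdist T x0 a \<le> n"])
    show "closedin function_top (\<Inter>x\<in>pverts T. \<Inter>y\<in>pverts T. {f \<in> topspace function_top.
        (f x = f y \<longrightarrow> x = y) \<and> ((f x, f y) \<in> parcs T \<longleftrightarrow> (x, y) \<in> parcs T)})"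
      using ne by (intro closedin_INT closedin_two_coordinates)
    show "closedin function_top (\<Inter>w\<in>pverts T.
        \<Union>v\<in>{v \<in> pverts T. gdist T x0 v \<le> n + gdist T x0 w}. {f \<in> topspace function_top. f v = w})"
    proof (intro closedin_INT closedin_Union finite_imageI finite_ball[OF x0])
      fix w S
      assume "w \<in> pverts T"
        and "S \<in> (\<lambda>v. {f \<in> topspace function_top. f v = w}) ` {v \<in> pverts T. gdist T x0 v \<le> n + gdist T x0 w}"
      then obtain v where v: "v \<in> pverts T" and S: "S = {f \<in> topspace function_top. f v = w}"
        by blast
      show "closedin function_top S"
        unfolding S by (rule closedin_two_coordinates[OF v v, of "\<lambda>a b. a = w"])
    qed (rule ne)
  qed
qed

text \<open>
  Such automorphisms map each vertex into a fixed finite ball, and the product of these balls is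
  compact by Tychonoff's theorem.
\<close>

lemma compactin_bounded_auts:
  assumes x0: "x0 \<in> pverts T"
  shows "compactin function_top (bounded_auts x0 n)"
proof (rule closed_compactin)
  let ?K = "PiE (pverts T) (\<lambda>v. {w \<in> pverts T. gdist T x0 w \<le> n + gdist T x0 v})"
  show "compactin function_top ?K"
    unfolding function_top_def
    by (simp add: compactin_PiE compactin_discrete_topology finite_ball[OF x0])
  show "bounded_auts x0 n \<subseteq> ?K"
  proof
    fix g
    assume "g \<in> bounded_auts x0 n"
    then have g: "g \<in> carrier (aut_group T)" and n: "gdist T x0 (g x0) \<le> n"
      by (auto simp: bounded_auts_def)
    have "gdist T x0 (g v) \<le> n + gdist T x0 v" if v: "v \<in> pverts T" for v
      using gdist_triangle[OF x0 aut_groupD(4)[OF g x0] aut_groupD(4)[OF g v]]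
        gdist_aut[OF g x0 v] n by simp
    then show "g \<in> ?K"
      using aut_groupD(2,4)[OF g] by (simp add: PiE_iff)
  qed
qed (rule closedin_bounded_auts[OF x0])

text \<open>
  The square norm of the cocycle is at least \<open>|g|\<close> minus a constant, so a bound on the norm bounds
  \<open>|g|\<close>.
\<close>

lemma is_proper_harmonic_cocycle:
  assumes G: "subgroup G (aut_group T)" "closedin (aut_top T) G" and x0: "x0 \<in> pverts T"
  shows "is_proper T G (harmonic_cocycle T x0)"
  unfolding is_proper_def
proof
  fix R :: real
  define c where "c = 2 * real q / ((real q)\<^sup>2 - 1)"
  define n where "n = nat \<lceil>R\<^sup>2 + c\<rceil>"
  let ?E = "{g \<in> G. edge_norm T (harmonic_cocycle T x0 g) \<le> R}"
  let ?X = "subtopology (aut_top T) G"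
  have c: "c \<ge> 0"
    using q_square_gt_1 by (simp add: c_def)
  have aut_top: "aut_top T = subtopology function_top (carrier (aut_group T))"
    by (simp add: aut_top_def function_top_def)
  have sub: "bounded_auts x0 n \<subseteq> carrier (aut_group T)"
    by (auto simp: bounded_auts_def)
  have closed: "closedin ?X (bounded_auts x0 n \<inter> G)"
  proof -
    have "closedin (aut_top T) (bounded_auts x0 n)"
      unfolding aut_top closedin_subtopology using closedin_bounded_auts[OF x0] sub by blast
    then show ?thesis
      unfolding closedin_subtopology by blast
  qed
  have compact: "compactin ?X (bounded_auts x0 n \<inter> G)"
  proof -
    have "compactin (aut_top T) (bounded_auts x0 n)"
      unfolding aut_top compactin_subtopology using compactin_bounded_auts[OF x0] sub by blast
    then have "compactin (aut_top T) (bounded_auts x0 n \<inter> G)"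
      using G(2) by (rule compact_Int_closedin)
    then show ?thesis
      by (simp add: compactin_subtopology)
  qed
  have "?E \<subseteq> bounded_auts x0 n \<inter> G"
  proof
    fix g
    assume g: "g \<in> ?E"
    then have aut: "g \<in> carrier (aut_group T)"
      using subgroup.mem_carrier[OF G(1)] by blast
    note gx = aut_groupD(4)[OF aut x0]
    let ?d = "gdist T x0 (g x0)"
    have pow: "real q powi (- int ?d) \<ge> 0"
      by simp
    have "real ?d - c \<le> real ?d + c * (real q powi (- int ?d) - 1)"
      using mult_nonneg_nonneg[OF c pow] by (simp add: right_diff_distrib)
    also have "\<dots> = (edge_norm T (harmonic_cocycle T x0 g))\<^sup>2"
      unfolding harmonic_cocycle_eq[of x0 g, OF x0 gx] c_def by (rule edge_norm_harmonic_form[OF x0 gx, symmetric])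
    also have "\<dots> \<le> R\<^sup>2"
      using g by (intro power_mono) (auto simp: edge_norm_def edge_inner_self_nonneg)
    finally have "?d \<le> n"
      unfolding n_def by linarith
    then show "g \<in> bounded_auts x0 n \<inter> G"
      using g aut by (simp add: bounded_auts_def)
  qed
  then have "?X closure_of ?E \<subseteq> bounded_auts x0 n \<inter> G"
    by (rule closure_of_minimal[OF _ closed])
  then show "compactin ?X (?X closure_of ?E)"
    by (rule closed_compactin[OF compact]) (rule closedin_closure_of)
qed

end

lemma homogeneous_treeI:
  assumes "q \<ge> 2" "regular_tree (q + 1) T"
  shows "homogeneous_tree T q"
proof -
  interpret pair_bidirected_digraph T
    using assms by (simp add: regular_tree_def)
  show ?thesis
    using assms by unfold_locales (auto simp: regular_tree_def)
qed

theorem corollary4p4: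
  fixes q :: nat
    and T :: "'v pair_pre_digraph"
    and G :: "('v \<Rightarrow> 'v) set"
    and x0 :: 'v
  assumes "q \<ge> 2"
    and "regular_tree (q + 1) T"
    and "subgroup G (aut_group T)"
    and "closedin (aut_top T) G"
    and "\<not> compactin (aut_top T) G"
    and "vertex_transitive T G"
    and "boundary_transitive T G"
    and "x0 \<in> pverts T"
  shows
    "is_cocycle T G (ker_grad_adj T) (harmonic_cocycle T x0) \<and>
     is_proper T G (harmonic_cocycle T x0) \<and>
     (\<forall>g\<in>G. (edge_norm T (harmonic_cocycle T x0 g))\<^sup>2 =
        real (gdist T x0 (g x0)) +
        2 * real q / ((real q)\<^sup>2 - 1) * (real q powi (- int (gdist T x0 (g x0))) - 1)) \<and>
     (\<exists>!F. F \<in> pverts T \<rightarrow>\<^sub>E ker_grad_adj T \<and>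
        (\<forall>g\<in>G. F (g x0) = harmonic_cocycle T x0 g)) \<and>
     (\<forall>F. F \<in> pverts T \<rightarrow>\<^sub>E ker_grad_adj T \<and>
        (\<forall>g\<in>G. F (g x0) = harmonic_cocycle T x0 g) \<longrightarrow>
          (\<forall>g\<in>G. \<forall>x\<in>pverts T.
             F (g x) = (\<lambda>e. edge_rep T g (F x) e + harmonic_cocycle T x0 g e)) \<and>
          (\<forall>x1. (x0, x1) \<in> parcs T \<longrightarrow>
             (let A = (real q + 1) * (edge_norm T (F x1))\<^sup>2 / (real q - 1);
                  B = 2 * real q * (edge_norm T (F x1))\<^sup>2 / (real q - 1)\<^sup>2
              in \<forall>x\<in>pverts T. (edge_norm T (F x))\<^sup>2 =
                   A * real (gdist T x x0) - B + B * real q powi (- int (gdist T x x0)))))"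
    (is "?cocycle \<and> ?proper \<and> ?norm \<and> (\<exists>!F. ?orbit F) \<and> (\<forall>F. _ \<longrightarrow> ?equivariant F \<and> ?growth F)")
proof -
  interpret homogeneous_tree T q
    using assms(1,2) by (rule homogeneous_treeI)
  note x0 = assms(8)
  have aut: "g \<in> carrier (aut_group T)" if "g \<in> G" for g
    using subgroup.mem_carrier[OF assms(3) that] .
  have gx: "g x \<in> pverts T" if "g \<in> G" "x \<in> pverts T" for g x
    by (rule aut_groupD(4)[OF aut[OF that(1)] that(2)])
  have b: "harmonic_cocycle T x0 g = harmonic_form x0 (g x0)" if "g \<in> G" for g
    by (rule harmonic_cocycle_eq[of x0 g, OF x0 gx[OF that x0]])
  have orbit: "\<exists>g\<in>G. g x0 = x" if "x \<in> pverts T" for x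
    using assms(6) x0 that by (simp add: vertex_transitive_def)
  have ?norm
    using edge_norm_harmonic_form[OF x0 gx[OF _ x0]] b by simp
  have F_eq: "F x = harmonic_form x0 x" if "?orbit F" "x \<in> pverts T" for F x
    using orbit[OF that(2)] that(1) b by metis
  have "\<exists>!F. ?orbit F"
  proof (rule ex1I)
    show "?orbit (\<lambda>x\<in>pverts T. harmonic_form x0 x)"
      using gx[OF _ x0] b harmonic_form_in_ker[OF x0] by (auto simp: PiE_iff)
    show "F = (\<lambda>x\<in>pverts T. harmonic_form x0 x)" if "?orbit F" for F
    proof (rule extensionalityI[of _ "pverts T"])
      show "F \<in> extensional (pverts T)"
        using that by (simp add: PiE_iff)
      show "F x = (\<lambda>x\<in>pverts T. harmonic_form x0 x) x" if "x \<in> pverts T" for x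
        using F_eq[OF \<open>?orbit F\<close> that] that by simp
    qed simp
  qed
  moreover have "?equivariant F" if F: "?orbit F" for F
  proof (intro ballI)
    fix g x
    assume g: "g \<in> G" and x: "x \<in> pverts T"
    show "F (g x) = (\<lambda>e. edge_rep T g (F x) e + harmonic_cocycle T x0 g e)"
      unfolding F_eq[OF F x] F_eq[OF F gx[OF g x]] b[OF g] edge_rep_harmonic_form[OF aut[OF g] x0 x]
      by (rule harmonic_form_add)
  qed
  moreover have "?growth F" if F: "?orbit F" for F
  proof (intro allI impI)
    fix x1
    assume arc: "(x0, x1) \<in> parcs T"
    note x1 = in_arcsD2[OF arc]
    have q: "real q > 1"
      using q_ge_2 by simp
    have q2: "(real q)\<^sup>2 - 1 = (real q + 1) * (real q - 1)"
      by (simp add: power2_eq_square algebra_simps)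
    have "gdist T x0 x1 = 1"
      using gdist_neighbour[OF x0 arc] gdist_self[OF x0] by simp
    then have "(edge_norm T (F x1))\<^sup>2 = 1 + 2 * real q / ((real q + 1) * (real q - 1)) * (1 / real q - 1)"
      using edge_norm_harmonic_form[OF x0 x1] F_eq[OF F x1] q2 by (simp add: power_int_minus inverse_eq_divide)
    also have "\<dots> = (real q - 1) / (real q + 1)"
      using q by (simp add: divide_simps) (simp add: algebra_simps)
    finally have F1: "(edge_norm T (F x1))\<^sup>2 = (real q - 1) / (real q + 1)" .
    have A: "(real q + 1) * (edge_norm T (F x1))\<^sup>2 / (real q - 1) = 1"
      using q F1 by simp
    have B: "2 * real q * (edge_norm T (F x1))\<^sup>2 / (real q - 1)\<^sup>2 = 2 * real q / ((real q)\<^sup>2 - 1)"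
      using q unfolding F1 q2 by (simp add: power2_eq_square)
    have "(edge_norm T (F x))\<^sup>2 = 1 * real (gdist T x x0) - 2 * real q / ((real q)\<^sup>2 - 1) +
        2 * real q / ((real q)\<^sup>2 - 1) * real q powi (- int (gdist T x x0))" if x: "x \<in> pverts T" for x
      unfolding F_eq[OF F x] edge_norm_harmonic_form[OF x0 x] gdist_sym[OF x x0]
      by (simp add: right_diff_distrib)
    then show "let A = (real q + 1) * (edge_norm T (F x1))\<^sup>2 / (real q - 1);
        B = 2 * real q * (edge_norm T (F x1))\<^sup>2 / (real q - 1)\<^sup>2
      in \<forall>x\<in>pverts T. (edge_norm T (F x))\<^sup>2 =
        A * real (gdist T x x0) - B + B * real q powi (- int (gdist T x x0))"
      unfolding Let_def A B by blast
  qed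
  ultimately show ?thesis
    using is_cocycle_harmonic_cocycle[OF assms(3) x0] is_proper_harmonic_cocycle[OF assms(3,4) x0] \<open>?norm\<close>
    by blast
qed

end
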